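(* For each integer $r \ge 3$, \[ \ln s(n,r) = \frac{1}{n-r+1}\binom{n}{r}\Bigl(\ln(n-r+1) + 1 - r + o(1)\Bigr) \qquad \text{as } n \to \infty . \]
   Context: A matroid of rank $r$ on ground set $E$ is paving if every subset $F\subseteq E$ with $|F|<r$ is independent. It is sparse paving if it is paving and every hyperplane has cardinality $r-1$ or $r$. $s(n,r)$ denotes the number of sparse paving matroids of rank $r$ on the ground set $[n]=\{1,\dots,n\}$. *)

theory Defs
  imports Complex_Main "HOL-Library.Landau_Symbols"
begin

text \<open>A matroid on the finite ground set \<open>E\<close> is given by its family \<open>\<I>\<close> of independent sets.\<close>

locale matroid =
  fixes E :: "'a set" and \<I> :: "'a set set"
  assumes finite_ground: "finite E"
    and indep_subset_ground: "X \<in> \<I> \<Longrightarrow> X \<subseteq> E"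
    and indep_empty: "{} \<in> \<I>"
    and indep_subset: "X \<in> \<I> \<Longrightarrow> Y \<subseteq> X \<Longrightarrow> Y \<in> \<I>"
    and indep_augment:
      "X \<in> \<I> \<Longrightarrow> Y \<in> \<I> \<Longrightarrow> card X < card Y \<Longrightarrow> \<exists>y\<in>Y - X. insert y X \<in> \<I>"

definition rank_of :: "'a set set \<Rightarrow> 'a set \<Rightarrow> nat" where
  "rank_of \<I> X = Max (card ` {Y \<in> \<I>. Y \<subseteq> X})"

definition flat :: "'a set \<Rightarrow> 'a set set \<Rightarrow> 'a set \<Rightarrow> bool" where
  "flat E \<I> F \<longleftrightarrow> F \<subseteq> E \<and> (\<forall>x\<in>E - F. rank_of \<I> F < rank_of \<I> (insert x F))"

definition hyperplane :: "'a set \<Rightarrow> 'a set set \<Rightarrow> 'a set \<Rightarrow> bool" where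
  "hyperplane E \<I> H \<longleftrightarrow> flat E \<I> H \<and> rank_of \<I> H + 1 = rank_of \<I> E"

definition paving :: "'a set \<Rightarrow> 'a set set \<Rightarrow> bool" where
  "paving E \<I> \<longleftrightarrow> matroid E \<I> \<and> (\<forall>F\<subseteq>E. card F < rank_of \<I> E \<longrightarrow> F \<in> \<I>)"

definition sparse_paving :: "'a set \<Rightarrow> 'a set set \<Rightarrow> bool" where
  "sparse_paving E \<I> \<longleftrightarrow> paving E \<I> \<and>
     (\<forall>H. hyperplane E \<I> H \<longrightarrow> card H = rank_of \<I> E - 1 \<or> card H = rank_of \<I> E)"

definition num_sparse_paving :: "nat \<Rightarrow> nat \<Rightarrow> nat" where
  "num_sparse_paving n r =
     card {\<I> :: nat set set. sparse_paving {1..n} \<I> \<and> rank_of \<I> {1..n} = r}"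

lemma finite_sparse_paving:
  "finite {\<I> :: nat set set. sparse_paving {1..n} \<I> \<and> rank_of \<I> {1..n} = r}"
proof (rule finite_subset)
  show "{\<I> :: nat set set. sparse_paving {1..n} \<I> \<and> rank_of \<I> {1..n} = r} \<subseteq> Pow (Pow {1..n})"
    unfolding sparse_paving_def paving_def by (auto dest: matroid.indep_subset_ground)
qed simp

end

theory Submission
  imports Defs "HOL-Library.Ramsey" "HOL-Real_Asymp.Real_Asymp"
begin

text \<open>
  A sparse paving matroid of rank \<open>r\<close> on \<open>[n]\<close> is determined by its dependent \<open>r\<close>-sets, and these may be
  any family of \<open>r\<close>-sets that pairwise meet in fewer than \<open>r - 1\<close> points. Regarding an \<open>r\<close>-set as the
  edge consisting of its \<open>r\<close> facets, such families are the matchings of a linear \<open>k\<close>-uniform \<open>D\<close>-regular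
  hypergraph on \<open>N = binomial n (r - 1)\<close> vertices, where \<open>k = r\<close> and \<open>D = n - r + 1\<close>. With \<open>P = N / k\<close>
  the number of its matchings is \<open>exp (P * (ln D + 1 - k + o(1)))\<close>.

  Lower bound: choose edges greedily. As long as every uncovered vertex lies in \<open>(1 + o(1)) * D * x ^ (k - 1)\<close>
  free edges, \<open>x\<close> being the fraction of uncovered vertices, there are about \<open>P * D * x ^ k\<close> choices for
  the next edge. The relative error of a degree has almost no drift under a uniformly random choice, so
  the sum over the vertices of the hyperbolic cosines of the scaled errors, suitably damped, is a
  supermartingale. Weighting each matching by \<open>1\<close> minus this potential turns the probabilistic argument
  into an induction on the number of edges.

  Upper bound: reveal the edges of a uniformly random \<open>m\<close>-matching in random order. When a fraction \<open>x\<close>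
  of them is still hidden, a given edge is disjoint from everything revealed with probability about
  \<open>x ^ k\<close>, so the next edge has about \<open>P * D * x ^ k\<close> possible values on average. By the chain rule and
  concavity the logarithm of the number of \<open>m\<close>-matchings is at most the sum of the logarithms of these
  averages, minus \<open>ln m!\<close>.
\<close>

section \<open>Hypergraphs and matchings\<close>

definition degree :: "'v set set \<Rightarrow> 'v \<Rightarrow> nat" where
  "degree H v = card {e \<in> H. v \<in> e}"

definition matchings :: "'v set set \<Rightarrow> 'v set set set" where
  "matchings H = {M. M \<subseteq> H \<and> pairwise disjnt M}"

definition matchings_of_size :: "'v set set \<Rightarrow> nat \<Rightarrow> 'v set set set" where
  "matchings_of_size H i = {M \<in> matchings H. card M = i}"

definition free_edges :: "'v set set \<Rightarrow> 'v set set \<Rightarrow> 'v set set" where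
  "free_edges H M = {e \<in> H. disjnt e (\<Union>M)}"

lemma sum_degree:
  assumes "finite H" "finite X"
  shows "(\<Sum>v\<in>X. degree H v) = (\<Sum>e\<in>H. card (e \<inter> X))"
  unfolding degree_def using assms
  by (intro sum_multicount_gen) (auto intro: arg_cong[where f = card])

lemma free_edges_subset: "free_edges H M \<subseteq> H"
  by (auto simp: free_edges_def)

lemma free_edges_empty [simp]: "free_edges H {} = H"
  by (simp add: free_edges_def)

lemma free_edges_insert: "free_edges H (insert f M) = {e \<in> free_edges H M. disjnt e f}"
  by (auto simp: free_edges_def disjnt_iff)

locale hypergraph =
  fixes V :: "'v set" and H :: "'v set set"
  assumes finite_vertices: "finite V"
    and edges_subset: "H \<subseteq> Pow V"
    and edge_nonempty: "{} \<notin> H"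
begin

definition uncovered :: "'v set set \<Rightarrow> 'v set" where
  "uncovered M = V - \<Union>M"

lemma finite_edges: "finite H"
  using finite_subset[OF edges_subset] finite_vertices by simp

lemma finite_edge: "e \<in> H \<Longrightarrow> finite e"
  using edges_subset finite_vertices finite_subset by blast

lemma finite_matchings: "finite (matchings H)"
  by (rule finite_subset[of _ "Pow H"]) (auto simp: matchings_def finite_edges)

lemma finite_matchings_of_size: "finite (matchings_of_size H i)"
  by (simp add: matchings_of_size_def finite_matchings)

lemma finite_free_edges: "finite (free_edges H M)"
  using finite_subset[OF free_edges_subset finite_edges] .

lemma finite_uncovered: "finite (uncovered M)"
  by (simp add: uncovered_def finite_vertices)

lemma uncovered_insert: "uncovered (insert f M) = uncovered M - f"
  by (auto simp: uncovered_def)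

lemma free_edge_subset_uncovered: "f \<in> free_edges H M \<Longrightarrow> f \<subseteq> uncovered M"
  using edges_subset by (auto simp: free_edges_def uncovered_def disjnt_iff)

lemma free_edge_notin: "f \<in> free_edges H M \<Longrightarrow> f \<notin> M"
  using edge_nonempty by (cases "f = {}") (auto simp: free_edges_def disjnt_iff)

lemma matchings_of_sizeD:
  assumes "M \<in> matchings_of_size H i"
  shows "M \<subseteq> H" "pairwise disjnt M" "card M = i" "finite M"
  using assms finite_subset[OF _ finite_edges] by (auto simp: matchings_of_size_def matchings_def)

lemma matchings_of_size_0: "matchings_of_size H 0 = {{}}"
proof -
  have "M = {}" if "M \<in> matchings_of_size H 0" for M
    using matchings_of_sizeD(3,4)[OF that] by simp
  then show ?thesis
    by (auto simp: matchings_of_size_def matchings_def)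
qed

lemma subset_matching:
  assumes "M \<in> matchings_of_size H m" "I \<subseteq> M"
  shows "I \<in> matchings_of_size H (card I)"
  using assms by (auto simp: matchings_of_size_def matchings_def intro: pairwise_subset)

lemma matching_Int_free_edges:
  assumes "M \<in> matchings_of_size H m" "I \<subseteq> M"
  shows "M \<inter> free_edges H I = M - I"
proof -
  have "disjnt f e" if "f \<in> M - I" "e \<in> I" for f e
    using pairwiseD[OF matchings_of_sizeD(2)[OF assms(1)], of f e] that assms(2) by auto
  then have "f \<in> free_edges H I" if "f \<in> M - I" for f
    using that matchings_of_sizeD(1)[OF assms(1)] by (auto simp: free_edges_def)
  then show ?thesis
    using free_edge_notin[of _ I] by auto
qed

lemma insert_free_edge:
  assumes "M \<in> matchings_of_size H i" "f \<in> free_edges H M"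
  shows "insert f M \<in> matchings_of_size H (Suc i)"
proof -
  have "pairwise disjnt (insert f M)"
    using assms matchings_of_sizeD(2)[OF assms(1)]
    by (auto simp: pairwise_insert free_edges_def disjnt_sym)
  then show ?thesis
    using assms free_edge_notin[OF assms(2)] matchings_of_sizeD[OF assms(1)]
      free_edges_subset[of H M]
    by (auto simp: matchings_of_size_def matchings_def)
qed

lemma remove_edge:
  assumes "J \<in> matchings_of_size H (Suc i)" "f \<in> J"
  shows "J - {f} \<in> matchings_of_size H i" "f \<in> free_edges H (J - {f})"
proof -
  show "J - {f} \<in> matchings_of_size H i"
    using subset_matching[of J "Suc i" "J - {f}"] matchings_of_sizeD[OF assms(1)] assms by auto
  show "f \<in> free_edges H (J - {f})"
    using matching_Int_free_edges[OF assms(1), of "J - {f}"] assms(2) by auto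
qed

lemma sum_free_edges_eq_sum_matchings_Suc:
  fixes g :: "'v set set \<Rightarrow> real"
  shows "(\<Sum>M\<in>matchings_of_size H i. \<Sum>f\<in>free_edges H M. g (insert f M)) =
    (real i + 1) * (\<Sum>J\<in>matchings_of_size H (Suc i). g J)"
proof -
  have "(\<Sum>M\<in>matchings_of_size H i. \<Sum>f\<in>free_edges H M. g (insert f M))
      = (\<Sum>(M, f)\<in>Sigma (matchings_of_size H i) (free_edges H). g (insert f M))"
    by (subst sum.Sigma) (auto simp: finite_matchings_of_size finite_free_edges)
  also have "\<dots> = (\<Sum>(J, f)\<in>Sigma (matchings_of_size H (Suc i)) (\<lambda>J. J). g J)"
    by (rule sum.reindex_bij_witness[where
          j = "\<lambda>(M, f). (insert f M, f)" and i = "\<lambda>(J, f). (J - {f}, f)"])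
       (auto simp: insert_free_edge remove_edge insert_absorb free_edge_notin)
  also have "\<dots> = (\<Sum>J\<in>matchings_of_size H (Suc i). \<Sum>f\<in>J. g J)"
    by (subst sum.Sigma) (auto simp: finite_matchings_of_size dest: matchings_of_sizeD(4))
  also have "\<dots> = (\<Sum>J\<in>matchings_of_size H (Suc i). (real i + 1) * g J)"
    by (rule sum.cong) (auto dest: matchings_of_sizeD(3))
  finally show ?thesis
    by (simp add: sum_distrib_left)
qed

lemma card_matchings_pos: "0 < card (matchings H)"
  using finite_matchings by (auto simp: card_gt_0_iff matchings_def)

lemma card_matchings_of_size_le: "card (matchings_of_size H m) \<le> card (matchings H)"
  by (rule card_mono) (auto simp: finite_matchings matchings_of_size_def)

end

locale uniform_hypergraph = hypergraph +
  fixes k :: nat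
  assumes card_edge: "e \<in> H \<Longrightarrow> card e = k"
    and k_pos: "0 < k"
begin

definition max_size :: real where
  "max_size = real (card V) / real k"

definition free_fraction :: "nat \<Rightarrow> real" where
  "free_fraction i = 1 - real i / max_size"

lemma sum_degree_free_edges:
  "(\<Sum>v\<in>uncovered M. degree (free_edges H M) v) = k * card (free_edges H M)"
proof -
  have "(\<Sum>v\<in>uncovered M. degree (free_edges H M) v) = (\<Sum>e\<in>free_edges H M. card (e \<inter> uncovered M))"
    by (rule sum_degree[OF finite_free_edges finite_uncovered])
  also have "\<dots> = (\<Sum>e\<in>free_edges H M. k)"
    using free_edge_subset_uncovered free_edges_subset[of H M] card_edge
    by (intro sum.cong) (auto simp: Int_absorb2 subset_iff)
  finally show ?thesis
    by simp
qed

lemma card_Union_matching: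
  assumes "M \<in> matchings_of_size H i"
  shows "card (\<Union>M) = i * k"
proof -
  have "card (\<Union>M) = (\<Sum>e\<in>M. card e)"
    using matchings_of_sizeD[OF assms] finite_edge by (intro card_Union_disjoint) auto
  also have "\<dots> = (\<Sum>e\<in>M. k)"
    using matchings_of_sizeD(1)[OF assms] card_edge by (intro sum.cong) auto
  finally show ?thesis
    using matchings_of_sizeD(3)[OF assms] by simp
qed

lemma matching_size_le:
  assumes "M \<in> matchings_of_size H i"
  shows "i * k \<le> card V"
proof -
  have "card (\<Union>M) \<le> card V"
    using matchings_of_sizeD(1)[OF assms] edges_subset by (intro card_mono finite_vertices) auto
  then show ?thesis
    by (simp only: card_Union_matching[OF assms])
qed

lemma matching_size_le_max_size:
  assumes "M \<in> matchings_of_size H i"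
  shows "real i \<le> max_size"
proof -
  have "real (i * k) \<le> real (card V)"
    using matching_size_le[OF assms] by (rule of_nat_mono)
  then show ?thesis
    using k_pos by (simp add: max_size_def pos_le_divide_eq)
qed

lemma card_uncovered:
  assumes "M \<in> matchings_of_size H i"
  shows "real (card (uncovered M)) = real (card V) - real k * real i"
proof -
  have "\<Union>M \<subseteq> V"
    using matchings_of_sizeD(1)[OF assms] edges_subset by blast
  then have "card (uncovered M) = card V - i * k"
    unfolding uncovered_def card_Union_matching[OF assms, symmetric]
    by (intro card_Diff_subset finite_subset[OF _ finite_vertices])
  then show ?thesis
    using matching_size_le[OF assms] by (simp add: of_nat_diff mult.commute)
qed

lemma matchings_eq_UN_matchings_of_size: "matchings H = (\<Union>m\<le>card V. matchings_of_size H m)"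
proof -
  have "m \<le> card V" if "M \<in> matchings_of_size H m" for m M
  proof -
    have "m * 1 \<le> m * k"
      using k_pos by (intro mult_left_mono) auto
    then show ?thesis
      using matching_size_le[OF that] by linarith
  qed
  then show ?thesis
    by (auto simp: matchings_of_size_def)
qed

end

locale linear_hypergraph = hypergraph +
  assumes card_Int_edges_le: "e \<in> H \<Longrightarrow> f \<in> H \<Longrightarrow> e \<noteq> f \<Longrightarrow> card (e \<inter> f) \<le> 1"
begin

lemma edge_eqI:
  assumes "e \<in> H" "f \<in> H" "v \<in> e \<inter> f" "w \<in> e \<inter> f" "v \<noteq> w"
  shows "e = f"
proof (rule ccontr)
  assume "e \<noteq> f"
  then have "card (e \<inter> f) \<le> 1"
    using assms card_Int_edges_le by blast
  moreover have "card {v, w} \<le> card (e \<inter> f)"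
    using assms finite_edge by (intro card_mono) auto
  ultimately show False
    using assms by simp
qed

end

locale regular_linear_hypergraph = uniform_hypergraph V H k + linear_hypergraph V H
  for V :: "'v set" and H :: "'v set set" and k :: nat +
  fixes D :: nat
  assumes degree_eq: "v \<in> V \<Longrightarrow> degree H v = D"
    and k_ge_2: "2 \<le> k"
    and D_pos: "0 < D"
    and vertices_nonempty: "V \<noteq> {}"
begin

lemma card_vertices_pos: "0 < card V"
  using finite_vertices vertices_nonempty by (simp add: card_gt_0_iff)

lemma max_size_pos: "0 < max_size"
  using card_vertices_pos k_pos by (simp add: max_size_def)

lemma card_vertices_eq: "real (card V) = real k * max_size"
  using k_pos by (simp add: max_size_def)

lemma card_uncovered_eq:
  assumes "M \<in> matchings_of_size H i"
  shows "real (card (uncovered M)) = real (card V) * free_fraction i"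
  using card_uncovered[OF assms] max_size_pos
  by (simp add: card_vertices_eq free_fraction_def algebra_simps)

lemma card_edges: "real (card H) = max_size * real D"
proof -
  have "(\<Sum>v\<in>V. degree H v) = k * card H"
    using sum_degree_free_edges[of "{}"] by (simp add: uncovered_def)
  then have "card V * D = k * card H"
    by (simp add: degree_eq)
  then have "real (card V) * real D = real k * real (card H)"
    by (metis of_nat_mult)
  then show ?thesis
    using k_pos by (simp add: card_vertices_eq)
qed

text \<open>The edges through a vertex are disjoint apart from that vertex.\<close>

lemma card_vertices_gt: "(k - 1) * D < card V"
proof -
  obtain v where v: "v \<in> V"
    using vertices_nonempty by blast
  let ?S = "{e \<in> H. v \<in> e}"
  have "card (\<Union>e\<in>?S. e - {v}) = (\<Sum>e\<in>?S. card (e - {v}))"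
    by (intro card_UN_disjoint) (auto simp: finite_edges finite_edge dest: edge_eqI[of _ _ v])
  also have "\<dots> = (\<Sum>e\<in>?S. k - 1)"
    by (intro sum.cong) (auto simp: card_edge card_Diff_singleton finite_edge)
  also have "\<dots> = (k - 1) * D"
    using degree_eq[OF v] by (simp add: degree_def)
  finally have "(k - 1) * D = card (\<Union>e\<in>?S. e - {v})" ..
  also have "\<dots> < card V"
    using edges_subset v by (intro psubset_card_mono finite_vertices) auto
  finally show ?thesis .
qed

end

section \<open>Free edges lost when a matching is extended\<close>

context hypergraph
begin

text \<open>No loss is recorded for \<open>v \<in> f\<close>, because such a \<open>v\<close> leaves the set of uncovered vertices.\<close>

definition loss :: "'v set set \<Rightarrow> 'v \<Rightarrow> 'v set \<Rightarrow> nat" where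
  "loss M v f = (if v \<in> f then 0 else card {e \<in> free_edges H M. v \<in> e \<and> \<not> disjnt e f})"

lemma degree_insert:
  assumes "v \<notin> f"
  shows "degree (free_edges H (insert f M)) v + loss M v f = degree (free_edges H M) v"
proof -
  have "{e \<in> free_edges H M. v \<in> e} =
      {e \<in> free_edges H (insert f M). v \<in> e} \<union> {e \<in> free_edges H M. v \<in> e \<and> \<not> disjnt e f}"
    by (auto simp: free_edges_insert)
  then have "degree (free_edges H M) v = card \<dots>"
    by (simp add: degree_def)
  also have "\<dots> = degree (free_edges H (insert f M)) v + loss M v f"
    unfolding degree_def loss_def using assms
    by (subst card_Un_disjoint) (auto simp: finite_free_edges free_edges_insert)
  finally show ?thesis ..
qed

end

context linear_hypergraph
begin

lemma loss_le:
  assumes "f \<in> H"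
  shows "loss M v f \<le> card f"
proof (cases "v \<in> f")
  case False
  define S where "S = {e \<in> free_edges H M. v \<in> e \<and> \<not> disjnt e f}"
  have "\<exists>p. \<forall>e\<in>S. p e \<in> e \<inter> f"
    by (rule bchoice) (auto simp: S_def disjnt_iff)
  then obtain p where p: "\<And>e. e \<in> S \<Longrightarrow> p e \<in> e \<inter> f"
    by blast
  have "inj_on p S"
  proof (rule inj_onI)
    fix e e' assume "e \<in> S" "e' \<in> S" "p e = p e'"
    then show "e = e'"
      using p[of e] p[of e'] False free_edges_subset
      by (intro edge_eqI[of e e' v "p e"]) (auto simp: S_def)
  qed
  moreover have "p ` S \<subseteq> f"
    using p by blast
  ultimately have "card S \<le> card f"
    using card_inj_on_le finite_edge[OF assms] by blast
  then show ?thesis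
    using False by (simp add: loss_def S_def)
qed (simp add: loss_def)

lemma card_free_edges_meeting:
  assumes e: "e \<in> free_edges H M" and v: "v \<in> e"
  shows "card {f \<in> free_edges H M. v \<notin> f \<and> \<not> disjnt e f} =
    (\<Sum>w\<in>e - {v}. degree (free_edges H M) w - 1)"
proof -
  let ?through = "\<lambda>w. {f \<in> free_edges H M. w \<in> f} - {e}"
  have eH: "e \<in> H"
    using e free_edges_subset by blast
  have "v \<notin> f" if "w \<in> e - {v}" "f \<in> ?through w" for w f
    using that v eH edge_eqI[of e f v w] free_edges_subset by blast
  then have "{f \<in> free_edges H M. v \<notin> f \<and> \<not> disjnt e f} = (\<Union>w\<in>e - {v}. ?through w)"
    using v by (fastforce simp: disjnt_iff)
  also have "card \<dots> = (\<Sum>w\<in>e - {v}. card (?through w))"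
  proof (rule card_UN_disjoint)
    show "\<forall>w\<in>e - {v}. \<forall>w'\<in>e - {v}. w \<noteq> w' \<longrightarrow> ?through w \<inter> ?through w' = {}"
      using eH free_edges_subset by (auto dest: edge_eqI[of e])
  qed (auto simp: finite_free_edges finite_edge eH)
  also have "\<dots> = (\<Sum>w\<in>e - {v}. degree (free_edges H M) w - 1)"
    using e by (intro sum.cong) (auto simp: degree_def card_Diff_singleton finite_free_edges)
  finally show ?thesis .
qed

lemma sum_loss:
  "(\<Sum>f\<in>free_edges H M. loss M v f) =
    (\<Sum>e\<in>{e \<in> free_edges H M. v \<in> e}. \<Sum>w\<in>e - {v}. degree (free_edges H M) w - 1)"
proof -
  let ?A = "free_edges H M" and ?E = "{e \<in> free_edges H M. v \<in> e}"
  have "(\<Sum>f\<in>?A. loss M v f) = (\<Sum>f\<in>?A. card {e \<in> ?E. v \<notin> f \<and> \<not> disjnt e f})"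
    by (intro sum.cong) (auto simp: loss_def conj_ac intro!: arg_cong[where f = card])
  also have "\<dots> = (\<Sum>e\<in>?E. card {f \<in> ?A. v \<notin> f \<and> \<not> disjnt e f})"
    by (rule sum_multicount_gen) (auto simp: finite_free_edges)
  also have "\<dots> = (\<Sum>e\<in>?E. \<Sum>w\<in>e - {v}. degree ?A w - 1)"
    by (intro sum.cong refl card_free_edges_meeting) auto
  finally show ?thesis .
qed

end

section \<open>Exponential moments\<close>

lemma exp_le_quadratic:
  fixes y :: real
  assumes "\<bar>y\<bar> \<le> 1"
  shows "exp y \<le> 1 + y + y\<^sup>2"
proof (cases "0 \<le> y")
  case True
  then show ?thesis
    using assms exp_bound[of y] by simp
next
  case False
  define x where "x = - y"
  have x: "0 < x" "x \<le> 1"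
    using False assms by (auto simp: x_def)
  have "(1 - x + x\<^sup>2) * (1 + x + x\<^sup>2 / 2) = 1 + x\<^sup>2 / 2 + x ^ 3 / 2 + x ^ 4 / 2"
    by (simp add: field_simps power2_eq_square power3_eq_cube power4_eq_xxxx)
  then have "1 \<le> (1 - x + x\<^sup>2) * (1 + x + x\<^sup>2 / 2)"
    using x by simp
  also have "\<dots> \<le> (1 - x + x\<^sup>2) * exp x"
    using exp_lower_Taylor_quadratic[of x] x by (intro mult_left_mono) auto
  finally have "exp (- x) \<le> 1 - x + x\<^sup>2"
    by (simp add: exp_minus field_simps)
  then show ?thesis
    by (simp add: x_def)
qed

lemma cosh_add_le:
  fixes z y :: real
  assumes "\<bar>y\<bar> \<le> 1"
  shows "cosh (z + y) \<le> cosh z * (1 + y\<^sup>2) + sinh z * y"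
proof -
  have "2 * cosh (z + y) = exp z * exp y + exp (- z) * exp (- y)"
    by (simp add: cosh_def flip: exp_add)
  also have "\<dots> \<le> exp z * (1 + y + y\<^sup>2) + exp (- z) * (1 - y + y\<^sup>2)"
    using exp_le_quadratic[of y] exp_le_quadratic[of "- y"] assms
    by (intro add_mono mult_left_mono) auto
  also have "\<dots> = 2 * (cosh z * (1 + y\<^sup>2) + sinh z * y)"
    by (simp add: cosh_def sinh_def algebra_simps)
  finally show ?thesis
    by simp
qed

lemma sum_cosh_add_le:
  fixes z :: real and y :: "'a \<Rightarrow> real"
  assumes "\<And>a. a \<in> A \<Longrightarrow> \<bar>y a\<bar> \<le> 1"
  shows "(\<Sum>a\<in>A. cosh (z + y a)) \<le> cosh z * (real (card A) + \<bar>\<Sum>a\<in>A. y a\<bar> + (\<Sum>a\<in>A. (y a)\<^sup>2))"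
proof -
  have "\<bar>sinh z\<bar> \<le> cosh z"
    by (simp add: abs_le_iff sinh_def cosh_def)
  then have "\<bar>sinh z * (\<Sum>a\<in>A. y a)\<bar> \<le> cosh z * \<bar>\<Sum>a\<in>A. y a\<bar>"
    unfolding abs_mult by (rule mult_right_mono) simp
  moreover have "(\<Sum>a\<in>A. cosh (z + y a)) \<le> (\<Sum>a\<in>A. cosh z * (1 + (y a)\<^sup>2) + sinh z * y a)"
    by (intro sum_mono cosh_add_le assms)
  ultimately show ?thesis
    by (simp add: sum.distrib algebra_simps flip: sum_distrib_left)
qed

text \<open>The relative degree \<open>g\<close> of a vertex becomes \<open>\<rho> * (g - l f)\<close> when the edge \<open>f\<close> is chosen.
  The drift cancels to first order because \<open>\<rho>\<close> is close to \<open>1 + q\<close> and the mean of \<open>l f\<close> to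
  \<open>g * q\<close>.\<close>

context
  fixes A :: "'f set" and l :: "'f \<Rightarrow> real" and \<rho> g q \<epsilon> c :: real
  assumes loss_bounds: "\<And>f. f \<in> A \<Longrightarrow> 0 \<le> l f" "\<And>f. f \<in> A \<Longrightarrow> l f \<le> c"
    and sum_loss_near: "\<bar>sum l A - g * q * real (card A)\<bar> \<le> 4 * \<epsilon> * (g * q * real (card A))"
    and growth: "1 + q \<le> \<rho>" "\<rho> * (1 - q) \<le> 1"
    and g: "0 \<le> g" "g \<le> 5 / 4"
    and q: "0 \<le> q" "q \<le> \<epsilon>" "q \<le> c"
    and \<epsilon>: "\<epsilon> \<le> 1 / 4"
begin

lemma growth_le: "\<rho> \<le> 4 / 3" "\<rho> - 1 \<le> 4 / 3 * q" "1 \<le> \<rho>"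
proof -
  have "\<rho> * (3 / 4) \<le> \<rho> * (1 - q)"
    using growth q \<epsilon> by (intro mult_left_mono) auto
  then show "\<rho> \<le> 4 / 3"
    using growth by linarith
  then have "\<rho> * q \<le> 4 / 3 * q"
    using q by (intro mult_right_mono) auto
  then show "\<rho> - 1 \<le> 4 / 3 * q"
    using growth(2) by (simp add: algebra_simps)
qed (use growth q in linarith)

lemma abs_sum_drift_le: "\<bar>\<Sum>f\<in>A. \<rho> * (g - l f) - g\<bar> \<le> 8 * \<epsilon> * q * real (card A)"
proof -
  define a where "a = g * q * real (card A)"
  have "\<rho> * (1 - q) \<ge> (1 + q) * (1 - q)"
    using growth(1) q \<epsilon> by (intro mult_right_mono) auto
  then have "\<bar>\<rho> * (1 - q) - 1\<bar> \<le> q * q"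
    using growth(2) by (simp add: abs_le_iff algebra_simps)
  also have "\<dots> \<le> \<epsilon> * q"
    using q by (intro mult_right_mono) auto
  finally have first_order: "\<bar>\<rho> * (1 - q) - 1\<bar> \<le> \<epsilon> * q" .
  have "(\<Sum>f\<in>A. \<rho> * (g - l f) - g) = real (card A) * ((\<rho> - 1) * g) - \<rho> * sum l A"
    by (simp add: sum_subtractf right_diff_distrib sum_distrib_left left_diff_distrib)
  also have "\<dots> = g * real (card A) * (\<rho> * (1 - q) - 1) - \<rho> * (sum l A - a)"
    by (simp add: a_def algebra_simps)
  also have "\<bar>\<dots>\<bar> \<le> g * real (card A) * \<bar>\<rho> * (1 - q) - 1\<bar> + \<rho> * \<bar>sum l A - a\<bar>"
    using g growth_le(3) by (simp add: abs_mult order_trans[OF abs_triangle_ineq4])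
  also have "\<dots> \<le> g * real (card A) * (\<epsilon> * q) + 4 / 3 * (4 * \<epsilon> * a)"
    using first_order sum_loss_near g growth_le(1,3)
    by (intro add_mono mult_mono) (auto simp: a_def)
  also have "\<dots> = 19 / 3 * g * (\<epsilon> * q * real (card A))"
    by (simp add: a_def algebra_simps)
  also have "\<dots> \<le> 8 * (\<epsilon> * q * real (card A))"
    using g q by (intro mult_right_mono) auto
  finally show ?thesis
    by (simp add: mult.assoc)
qed

lemma drift_eq: "\<rho> * (g - l f) - g = (\<rho> - 1) * g - \<rho> * l f"
  by (simp add: algebra_simps)

lemma drift_terms_bounds:
  assumes "f \<in> A"
  shows "0 \<le> (\<rho> - 1) * g" "(\<rho> - 1) * g \<le> 5 / 3 * q" "0 \<le> \<rho> * l f" "\<rho> * l f \<le> 4 / 3 * l f"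
proof -
  have "(\<rho> - 1) * g \<le> 4 / 3 * q * (5 / 4)"
    using growth_le g q by (intro mult_mono) auto
  then show "(\<rho> - 1) * g \<le> 5 / 3 * q"
    by simp
  show "\<rho> * l f \<le> 4 / 3 * l f"
    using growth_le(1) loss_bounds(1)[OF assms] by (rule mult_right_mono)
qed (use growth_le(3) g loss_bounds(1)[OF assms] in auto)

lemma abs_drift_le: "f \<in> A \<Longrightarrow> \<bar>\<rho> * (g - l f) - g\<bar> \<le> 5 / 3 * c"
  using drift_terms_bounds[of f] loss_bounds[of f] q unfolding drift_eq by linarith

lemma sum_drift_sq_le: "(\<Sum>f\<in>A. (\<rho> * (g - l f) - g)\<^sup>2) \<le> 9 * c * q * real (card A)"
proof -
  have "(\<rho> * (g - l f) - g)\<^sup>2 \<le> 5 / 3 * c * (5 / 3 * q + 4 / 3 * l f)" if "f \<in> A" for f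
  proof -
    have "\<bar>\<rho> * (g - l f) - g\<bar> \<le> 5 / 3 * q + 4 / 3 * l f"
      using drift_terms_bounds[OF that] loss_bounds(1)[OF that] q(1) unfolding drift_eq by linarith
    then have "\<bar>\<rho> * (g - l f) - g\<bar> * \<bar>\<rho> * (g - l f) - g\<bar> \<le> 5 / 3 * c * (5 / 3 * q + 4 / 3 * l f)"
      using abs_drift_le[OF that] q by (intro mult_mono) auto
    then show ?thesis
      by (simp add: power2_eq_square)
  qed
  then have "(\<Sum>f\<in>A. (\<rho> * (g - l f) - g)\<^sup>2) \<le> (\<Sum>f\<in>A. 5 / 3 * c * (5 / 3 * q + 4 / 3 * l f))"
    by (rule sum_mono)
  also have "\<dots> = 5 / 3 * c * (5 / 3 * q * real (card A) + 4 / 3 * sum l A)"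
    unfolding sum_distrib_left[symmetric] sum.distrib by simp
  also have "\<dots> \<le> 5 / 3 * c * (5 / 3 * q * real (card A) + 4 / 3 * (5 / 2 * (q * real (card A))))"
  proof (intro mult_left_mono add_left_mono)
    have "4 * \<epsilon> * (g * (q * real (card A))) \<le> 1 * (g * (q * real (card A)))"
      using \<epsilon> g q by (intro mult_right_mono) auto
    moreover have "g * (q * real (card A)) \<le> 5 / 4 * (q * real (card A))"
      using g q by (intro mult_right_mono) auto
    ultimately show "sum l A \<le> 5 / 2 * (q * real (card A))"
      using sum_loss_near unfolding abs_le_iff mult.assoc[of g q] by linarith
  qed (use q in auto)
  also have "\<dots> = 25 / 3 * (c * q * real (card A))"
    by (simp add: algebra_simps)
  also have "\<dots> \<le> 9 * (c * q * real (card A))"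
    using q by (intro mult_right_mono) auto
  finally show ?thesis
    by (simp add: mult.assoc)
qed

lemma sum_cosh_drift_le:
  assumes \<theta>: "0 \<le> \<theta>" "9 * c * \<theta> \<le> \<epsilon>"
  shows "(\<Sum>f\<in>A. cosh (\<theta> * (\<rho> * (g - l f) - 1)))
    \<le> real (card A) * cosh (\<theta> * (g - 1)) * exp (9 * \<theta> * \<epsilon> * q)"
proof -
  define \<Delta> where "\<Delta> f = \<rho> * (g - l f) - g" for f
  have small: "\<bar>\<theta> * \<Delta> f\<bar> \<le> 1" if "f \<in> A" for f
  proof -
    have "\<bar>\<theta> * \<Delta> f\<bar> \<le> \<theta> * (5 / 3 * c)"
      using mult_left_mono[OF abs_drift_le[OF that] \<theta>(1)] \<theta>(1) by (simp add: \<Delta>_def abs_mult)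
    moreover have "0 \<le> \<theta> * c"
      using \<theta>(1) q by simp
    ultimately show ?thesis
      using \<theta>(2) \<epsilon> by (simp add: algebra_simps)
  qed
  have first_order: "\<bar>\<Sum>f\<in>A. \<theta> * \<Delta> f\<bar> \<le> \<theta> * (8 * \<epsilon> * q * real (card A))"
    using abs_sum_drift_le \<theta>(1) by (simp add: \<Delta>_def abs_mult mult_left_mono flip: sum_distrib_left)
  have "(\<Sum>f\<in>A. (\<theta> * \<Delta> f)\<^sup>2) \<le> \<theta>\<^sup>2 * (9 * c * q * real (card A))"
    using sum_drift_sq_le
    by (simp add: \<Delta>_def power_mult_distrib mult_left_mono flip: sum_distrib_left)
  also have "\<dots> = 9 * c * \<theta> * (\<theta> * q * real (card A))"
    by (simp add: power2_eq_square)
  also have "\<dots> \<le> \<epsilon> * (\<theta> * q * real (card A))"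
    using \<theta> q by (intro mult_right_mono) auto
  finally have second_order: "(\<Sum>f\<in>A. (\<theta> * \<Delta> f)\<^sup>2) \<le> \<theta> * \<epsilon> * q * real (card A)"
    by (simp add: ac_simps)
  have "(\<Sum>f\<in>A. cosh (\<theta> * (\<rho> * (g - l f) - 1))) = (\<Sum>f\<in>A. cosh (\<theta> * (g - 1) + \<theta> * \<Delta> f))"
    by (simp add: \<Delta>_def algebra_simps)
  also have "\<dots> \<le> cosh (\<theta> * (g - 1)) *
      (real (card A) + \<bar>\<Sum>f\<in>A. \<theta> * \<Delta> f\<bar> + (\<Sum>f\<in>A. (\<theta> * \<Delta> f)\<^sup>2))"
    using small by (rule sum_cosh_add_le)
  also have "\<dots> \<le> cosh (\<theta> * (g - 1)) * (real (card A) * (1 + 9 * \<theta> * \<epsilon> * q))"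
    using first_order second_order by (intro mult_left_mono) (auto simp: algebra_simps)
  also have "\<dots> \<le> cosh (\<theta> * (g - 1)) * (real (card A) * exp (9 * \<theta> * \<epsilon> * q))"
    using exp_ge_add_one_self by (intro mult_left_mono) auto
  finally show ?thesis
    by (simp add: ac_simps)
qed

end

section \<open>The greedy process\<close>

lemma power_inverse_bounds:
  fixes y :: real
  assumes "0 \<le> y" "y < 1"
  shows "1 + real j * y \<le> (1 / (1 - y)) ^ j" "(1 / (1 - y)) ^ j * (1 - real j * y) \<le> 1"
proof -
  have "1 + y \<le> 1 / (1 - y)"
    using assms by (simp add: field_simps)
  then have "(1 + y) ^ j \<le> (1 / (1 - y)) ^ j"
    using assms by (intro power_mono) auto
  moreover have "1 + real j * y \<le> (1 + y) ^ j"
    using Bernoulli_inequality[of y j] assms by (simp add: mult.commute)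
  ultimately show "1 + real j * y \<le> (1 / (1 - y)) ^ j"
    by linarith
  have "1 - real j * y \<le> (1 - y) ^ j"
    using Bernoulli_inequality[of "- y" j] assms by (simp add: mult.commute)
  then have "(1 / (1 - y)) ^ j * (1 - real j * y) \<le> (1 / (1 - y)) ^ j * (1 - y) ^ j"
    using assms by (intro mult_left_mono) auto
  also have "\<dots> = 1"
    using assms by (simp flip: power_mult_distrib)
  finally show "(1 / (1 - y)) ^ j * (1 - real j * y) \<le> 1" .
qed

lemma exp_abs_le_cosh: "exp \<bar>x\<bar> \<le> 2 * cosh (x :: real)"
  by (simp add: cosh_def abs_if)

lemma abs_sum_diff_const_le:
  fixes f :: "'a \<Rightarrow> real"
  assumes "\<And>a. a \<in> A \<Longrightarrow> \<bar>f a - c\<bar> \<le> b"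
  shows "\<bar>sum f A - real (card A) * c\<bar> \<le> real (card A) * b"
proof -
  have "\<bar>\<Sum>a\<in>A. f a - c\<bar> \<le> (\<Sum>a\<in>A. \<bar>f a - c\<bar>)"
    by (rule sum_abs)
  also have "\<dots> \<le> real (card A) * b"
    by (rule sum_bounded_above[OF assms])
  finally show ?thesis
    by (simp add: sum_subtractf)
qed

locale greedy_matching = regular_linear_hypergraph V H k D
  for V :: "'v set" and H :: "'v set set" and k D :: nat +
  fixes \<epsilon> \<theta> :: real
  assumes \<epsilon>_pos: "0 < \<epsilon>" and \<theta>_ge_1: "1 \<le> \<theta>"
begin

definition expected_degree :: "nat \<Rightarrow> real" where
  "expected_degree i = real D * free_fraction i ^ (k - 1)"

definition relative_degree :: "nat \<Rightarrow> 'v set set \<Rightarrow> 'v \<Rightarrow> real" where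
  "relative_degree i M v = real (degree (free_edges H M) v) / expected_degree i"

definition updated_degree :: "nat \<Rightarrow> 'v set set \<Rightarrow> 'v \<Rightarrow> 'v set \<Rightarrow> real" where
  "updated_degree i M v f = expected_degree i / expected_degree (Suc i) *
     (relative_degree i M v - real (loss M v f) / expected_degree i)"

definition decay :: "nat \<Rightarrow> real" where
  "decay i = (real k - 1) / (max_size - real i)"

text \<open>The exponent \<open>9 * k\<close> makes the tolerance grow by at least the factor \<open>1 + 9 * decay i\<close> in each
  step, which absorbs the drift bounded in \<open>sum_cosh_drift_le\<close>.\<close>

definition tolerance :: "nat \<Rightarrow> real" where
  "tolerance i = \<epsilon> / free_fraction i ^ (9 * k)"

definition potential :: "nat \<Rightarrow> 'v set set \<Rightarrow> real" where
  "potential i M = 2 * exp (- (\<theta> * tolerance i)) *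
     (\<Sum>v\<in>uncovered M. cosh (\<theta> * (relative_degree i M v - 1)))"

definition near_regular :: "nat \<Rightarrow> 'v set set \<Rightarrow> bool" where
  "near_regular i M \<longleftrightarrow> (\<forall>v\<in>uncovered M. \<bar>relative_degree i M v - 1\<bar> \<le> tolerance i)"

definition controlled :: "nat \<Rightarrow> bool" where
  "controlled i \<longleftrightarrow> 0 < free_fraction i \<and> tolerance i \<le> 1 / 4 \<and>
     9 * real k * \<theta> \<le> tolerance i * expected_degree i"

lemma potential_nonneg: "0 \<le> potential i M"
  unfolding potential_def by (intro mult_nonneg_nonneg sum_nonneg) auto

lemma near_regular_if_potential_less_1:
  assumes "potential i M < 1"
  shows "near_regular i M"
  unfolding near_regular_def
proof
  fix v assume v: "v \<in> uncovered M"
  let ?z = "relative_degree i M v - 1"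
  have "exp (\<theta> * \<bar>?z\<bar>) \<le> 2 * cosh (\<theta> * ?z)"
    using exp_abs_le_cosh[of "\<theta> * ?z"] \<theta>_ge_1 by (simp add: abs_mult)
  also have "\<dots> \<le> 2 * (\<Sum>v\<in>uncovered M. cosh (\<theta> * (relative_degree i M v - 1)))"
    using v finite_uncovered by (intro mult_left_mono member_le_sum) auto
  finally have "exp (- (\<theta> * tolerance i)) * exp (\<theta> * \<bar>?z\<bar>) \<le> potential i M"
    by (simp add: potential_def mult_left_mono)
  then have "exp (- (\<theta> * tolerance i)) * exp (\<theta> * \<bar>?z\<bar>) < 1"
    using assms by (rule le_less_trans)
  then have "\<theta> * (\<bar>?z\<bar> - tolerance i) < 0"
    by (simp add: right_diff_distrib flip: exp_add)
  then show "\<bar>?z\<bar> \<le> tolerance i"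
    using \<theta>_ge_1 by (simp add: mult_less_0_iff)
qed

lemma expected_degree_pos: "0 < free_fraction i \<Longrightarrow> 0 < expected_degree i"
  using D_pos by (simp add: expected_degree_def)

lemma tolerance_pos: "0 < free_fraction i \<Longrightarrow> 0 < tolerance i"
  using \<epsilon>_pos by (simp add: tolerance_def)

lemma free_fraction_le_1: "free_fraction i \<le> 1"
  using max_size_pos by (simp add: free_fraction_def)

lemma max_size_diff: "max_size - real i = max_size * free_fraction i"
  using max_size_pos by (simp add: free_fraction_def field_simps)

lemma decay_le:
  assumes "0 < free_fraction i"
  shows "decay i \<le> real k / expected_degree i"
proof -
  define x where "x = free_fraction i"
  have x: "0 < x" "x \<le> 1"
    using assms free_fraction_le_1 by (auto simp: x_def)
  have "real ((k - 1) * D) \<le> real k * max_size"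
    using card_vertices_gt unfolding card_vertices_eq[symmetric] by (intro of_nat_mono) simp
  then have D_le: "(real k - 1) * real D \<le> real k * max_size"
    using k_pos by (simp add: of_nat_diff)
  have "x ^ (k - 1) \<le> x ^ 1"
    using x k_ge_2 by (intro power_decreasing) auto
  then have "(real k - 1) * (real D * x ^ (k - 1)) \<le> (real k - 1) * (real D * x)"
    using k_pos by (intro mult_left_mono) auto
  also have "\<dots> \<le> real k * (max_size * x)"
    using mult_right_mono[OF D_le, of x] x by (simp add: ac_simps)
  finally show ?thesis
    using x max_size_pos D_pos
    by (simp add: decay_def max_size_diff expected_degree_def frac_le_eq divide_le_0_iff
        flip: x_def)
qed

lemma controlled_bounds:
  assumes "controlled i"
  shows "9 * (real k / expected_degree i) * \<theta> \<le> tolerance i" "1 \<le> tolerance i * expected_degree i"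
    "0 \<le> decay i" "decay i \<le> tolerance i" "1 < max_size - real i"
proof -
  have x: "0 < free_fraction i" and control: "9 * real k * \<theta> \<le> tolerance i * expected_degree i"
    using assms by (auto simp: controlled_def)
  note d = expected_degree_pos[OF x]
  show first: "9 * (real k / expected_degree i) * \<theta> \<le> tolerance i"
    using control d by (simp add: field_simps)
  have "9 * real k * 1 \<le> 9 * real k * \<theta>"
    using \<theta>_ge_1 by (intro mult_left_mono) auto
  then have "9 * real k \<le> tolerance i * expected_degree i"
    using control by simp
  then show "1 \<le> tolerance i * expected_degree i"
    using k_pos by linarith
  have "9 * (real k / expected_degree i) * 1 \<le> 9 * (real k / expected_degree i) * \<theta>"
    using \<theta>_ge_1 d by (intro mult_left_mono) auto
  moreover have "0 \<le> real k / expected_degree i"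
    using d by simp
  ultimately show decay_le_tol: "decay i \<le> tolerance i"
    using first decay_le[OF x] by linarith
  have pos: "0 < max_size - real i"
    using max_size_pos x by (simp add: max_size_diff)
  then show "0 \<le> decay i"
    using k_pos by (simp add: decay_def)
  have "1 / (max_size - real i) \<le> decay i"
    unfolding decay_def using pos k_ge_2 by (intro divide_right_mono) auto
  also have "\<dots> < 1"
    using decay_le_tol assms by (simp add: controlled_def)
  finally show "1 < max_size - real i"
    using pos by simp
qed

lemma free_fraction_Suc:
  assumes "0 < free_fraction i"
  shows "free_fraction (Suc i) = free_fraction i * (1 - 1 / (max_size - real i))"
  using assms max_size_pos unfolding max_size_diff by (simp add: free_fraction_def field_simps)

lemma decay_eq: "decay i = real (k - 1) * (1 / (max_size - real i))"
  using k_pos by (simp add: decay_def of_nat_diff)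

lemma expected_degree_growth:
  assumes "controlled i"
  shows "1 + decay i \<le> expected_degree i / expected_degree (Suc i)"
    "expected_degree i / expected_degree (Suc i) * (1 - decay i) \<le> 1"
    "0 < expected_degree (Suc i)"
proof -
  define y where "y = 1 / (max_size - real i)"
  have x: "0 < free_fraction i"
    using assms by (simp add: controlled_def)
  have y: "0 \<le> y" "y < 1"
    using controlled_bounds(5)[OF assms] by (auto simp: y_def)
  have "expected_degree i / expected_degree (Suc i) = (1 / (1 - y)) ^ (k - 1)"
    using x y D_pos
    by (simp add: expected_degree_def free_fraction_Suc[OF x] power_mult_distrib power_divide
        flip: y_def)
  then show "1 + decay i \<le> expected_degree i / expected_degree (Suc i)"
    and "expected_degree i / expected_degree (Suc i) * (1 - decay i) \<le> 1"
    using power_inverse_bounds[OF y, of "k - 1"] by (simp_all add: decay_eq y_def)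
  show "0 < expected_degree (Suc i)"
    using x y by (intro expected_degree_pos) (simp add: free_fraction_Suc y_def)
qed

lemma tolerance_Suc_ge:
  assumes "controlled i"
  shows "tolerance i * (1 + 9 * decay i) \<le> tolerance (Suc i)"
proof -
  define y where "y = 1 / (max_size - real i)"
  have x: "0 < free_fraction i"
    using assms by (simp add: controlled_def)
  have y: "0 \<le> y" "y < 1"
    using controlled_bounds(5)[OF assms] by (auto simp: y_def)
  have "1 + 9 * decay i \<le> 1 + real (9 * k) * y"
    using y by (simp add: decay_eq mult_right_mono flip: y_def)
  also have "\<dots> \<le> (1 / (1 - y)) ^ (9 * k)"
    by (rule power_inverse_bounds(1)[OF y])
  finally have "tolerance i * (1 + 9 * decay i) \<le> tolerance i * (1 / (1 - y)) ^ (9 * k)"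
    using tolerance_pos[OF x] by (intro mult_left_mono) auto
  also have "\<dots> = tolerance (Suc i)"
    by (simp add: tolerance_def free_fraction_Suc[OF x] power_mult_distrib power_divide flip: y_def)
  finally show ?thesis .
qed

lemma abs_degree_diff_le:
  assumes "controlled i" "near_regular i M" "v \<in> uncovered M"
  shows "\<bar>real (degree (free_edges H M) v) - expected_degree i\<bar> \<le> tolerance i * expected_degree i"
proof -
  have d: "0 < expected_degree i"
    using assms(1) expected_degree_pos by (simp add: controlled_def)
  have "real (degree (free_edges H M) v) - expected_degree i
      = (relative_degree i M v - 1) * expected_degree i"
    using d by (simp add: relative_degree_def left_diff_distrib)
  also have "\<bar>\<dots>\<bar> = \<bar>relative_degree i M v - 1\<bar> * expected_degree i"
    using d by (simp add: abs_mult)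
  also have "\<dots> \<le> tolerance i * expected_degree i"
    using assms(2,3) d by (intro mult_right_mono) (auto simp: near_regular_def)
  finally show ?thesis .
qed

lemma abs_card_free_edges_diff_le:
  assumes "controlled i" "near_regular i M" "M \<in> matchings_of_size H i"
  shows "\<bar>real (card (free_edges H M)) - (max_size - real i) * expected_degree i\<bar>
    \<le> tolerance i * ((max_size - real i) * expected_degree i)"
proof -
  define u where "u = max_size - real i"
  have "real (card (uncovered M)) = real k * u"
    using card_uncovered_eq[OF assms(3)] by (simp add: u_def max_size_diff card_vertices_eq)
  moreover have "(\<Sum>v\<in>uncovered M. real (degree (free_edges H M) v))
      = real k * real (card (free_edges H M))"
    using sum_degree_free_edges by (simp flip: of_nat_sum of_nat_mult)
  moreover have "\<bar>(\<Sum>v\<in>uncovered M. real (degree (free_edges H M) v))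
      - real (card (uncovered M)) * expected_degree i\<bar>
      \<le> real (card (uncovered M)) * (tolerance i * expected_degree i)"
    by (intro abs_sum_diff_const_le abs_degree_diff_le assms)
  ultimately have "\<bar>real k * (real (card (free_edges H M)) - u * expected_degree i)\<bar>
      \<le> real k * (tolerance i * (u * expected_degree i))"
    by (simp add: algebra_simps)
  then show ?thesis
    using k_pos by (simp add: abs_mult u_def)
qed

lemma abs_sum_loss_diff_le:
  fixes M :: "'v set set" and v :: 'v
  assumes "controlled i" "near_regular i M"
  defines "n \<equiv> real (degree (free_edges H M) v) * (real k - 1)"
  shows "\<bar>(\<Sum>f\<in>free_edges H M. real (loss M v f)) - n * expected_degree i\<bar>
    \<le> n * (2 * tolerance i * expected_degree i)"
proof -
  define S where "S = Sigma {e \<in> free_edges H M. v \<in> e} (\<lambda>e. e - {v})"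
  have edge: "finite e" "card (e - {v}) = k - 1" if "e \<in> free_edges H M" "v \<in> e" for e
    using that free_edges_subset[of H M] finite_edge[of e] card_edge[of e]
    by (auto simp: card_Diff_singleton)
  have "card S = (\<Sum>e\<in>{e \<in> free_edges H M. v \<in> e}. card (e - {v}))"
    unfolding S_def using edge(1) by (intro card_SigmaI) (auto simp: finite_free_edges)
  also have "\<dots> = degree (free_edges H M) v * (k - 1)"
    using edge(2) by (simp add: degree_def)
  finally have n: "real (card S) = n"
    using k_pos by (simp add: n_def of_nat_diff)
  have "(\<Sum>f\<in>free_edges H M. loss M v f) = (\<Sum>(e, w)\<in>S. degree (free_edges H M) w - 1)"
    unfolding sum_loss S_def using edge(1) by (intro sum.Sigma) (auto simp: finite_free_edges)
  then have "(\<Sum>f\<in>free_edges H M. real (loss M v f))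
      = (\<Sum>(e, w)\<in>S. real (degree (free_edges H M) w - 1))"
    by (simp add: case_prod_unfold flip: of_nat_sum)
  moreover have "\<bar>real (degree (free_edges H M) w - 1) - expected_degree i\<bar>
      \<le> 2 * tolerance i * expected_degree i"
    if "(e, w) \<in> S" for e w
  proof -
    have "w \<in> uncovered M"
      using that free_edge_subset_uncovered by (auto simp: S_def)
    then show ?thesis
      using abs_degree_diff_le[OF assms(1,2)] controlled_bounds(2)[OF assms(1)] by fastforce
  qed
  ultimately show ?thesis
    unfolding n[symmetric] by (simp only:) (intro abs_sum_diff_const_le, auto)
qed

lemma relative_degree_bounds:
  assumes "controlled i" "near_regular i M" "v \<in> uncovered M"
  shows "0 \<le> relative_degree i M v" "relative_degree i M v \<le> 5 / 4"
proof -
  show "0 \<le> relative_degree i M v"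
    using assms(1) expected_degree_pos[of i] by (simp add: relative_degree_def controlled_def)
  show "relative_degree i M v \<le> 5 / 4"
    using assms unfolding near_regular_def controlled_def by fastforce
qed

lemma abs_card_free_edges_mult_decay_diff_le:
  fixes M :: "'v set set"
  assumes control: "controlled i" "near_regular i M" and M: "M \<in> matchings_of_size H i"
    and v: "v \<in> uncovered M"
  defines "n \<equiv> real (degree (free_edges H M) v) * (real k - 1)"
  shows "\<bar>relative_degree i M v * decay i * real (card (free_edges H M)) - n\<bar> \<le> tolerance i * n"
proof -
  define d where "d = expected_degree i"
  define b where "b = relative_degree i M v * decay i"
  have d: "0 < d" and u: "0 < max_size - real i"
    using control(1) expected_degree_pos[of i] controlled_bounds(5)[OF control(1)]
    by (auto simp: d_def controlled_def)
  have b: "0 \<le> b"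
    unfolding b_def by (intro mult_nonneg_nonneg relative_degree_bounds controlled_bounds control v)
  have n: "n = b * ((max_size - real i) * d)"
    using d u by (simp add: b_def n_def relative_degree_def decay_def d_def)
  have "\<bar>b * real (card (free_edges H M)) - n\<bar>
      = b * \<bar>real (card (free_edges H M)) - (max_size - real i) * d\<bar>"
    using b by (simp add: n flip: right_diff_distrib abs_mult_pos')
  also have "\<dots> \<le> b * (tolerance i * ((max_size - real i) * d))"
    unfolding d_def using abs_card_free_edges_diff_le[OF control M] b by (rule mult_left_mono)
  finally show ?thesis
    unfolding b_def[symmetric] by (simp add: n ac_simps)
qed

lemma abs_sum_relative_loss_diff_le:
  fixes M :: "'v set set"
  assumes control: "controlled i" "near_regular i M" and M: "M \<in> matchings_of_size H i"
    and v: "v \<in> uncovered M"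
  defines "a \<equiv> relative_degree i M v * decay i * real (card (free_edges H M))"
  shows "\<bar>(\<Sum>f\<in>free_edges H M. real (loss M v f) / expected_degree i) - a\<bar> \<le> 4 * tolerance i * a"
proof -
  define d where "d = expected_degree i"
  define n where "n = real (degree (free_edges H M) v) * (real k - 1)"
  have tol: "0 < tolerance i" "tolerance i \<le> 1 / 4" and d: "0 < d"
    using control(1) expected_degree_pos[of i] tolerance_pos[of i]
    by (auto simp: d_def controlled_def)
  have n: "0 \<le> n"
    using k_pos by (simp add: n_def)
  have a_near: "\<bar>a - n\<bar> \<le> tolerance i * n"
    unfolding a_def n_def by (rule abs_card_free_edges_mult_decay_diff_le[OF control M v])
  have "(\<Sum>f\<in>free_edges H M. real (loss M v f) / d) - n
      = ((\<Sum>f\<in>free_edges H M. real (loss M v f)) - n * d) / d"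
    using d by (simp add: diff_divide_distrib flip: sum_divide_distrib)
  also have "\<bar>\<dots>\<bar> = \<bar>(\<Sum>f\<in>free_edges H M. real (loss M v f)) - n * d\<bar> / d"
    using d by simp
  also have "\<dots> \<le> n * (2 * tolerance i * d) / d"
    unfolding n_def d_def
    using abs_sum_loss_diff_le[OF control] less_imp_le[OF d[unfolded d_def]]
    by (rule divide_right_mono)
  finally have "\<bar>(\<Sum>f\<in>free_edges H M. real (loss M v f) / d) - n\<bar> \<le> 2 * tolerance i * n"
    using d by (simp add: ac_simps)
  then have "\<bar>(\<Sum>f\<in>free_edges H M. real (loss M v f) / d) - a\<bar> \<le> tolerance i * (3 * n)"
    using a_near by linarith
  also have "3 * n \<le> 4 * a"
  proof -
    have "tolerance i * n \<le> 1 / 4 * n"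
      using tol(2) n by (rule mult_right_mono)
    then show ?thesis
      using a_near by linarith
  qed
  then have "tolerance i * (3 * n) \<le> tolerance i * (4 * a)"
    using tol(1) by (intro mult_left_mono) auto
  finally show ?thesis
    by (simp add: d_def)
qed

lemma relative_degree_insert:
  assumes "controlled i" "v \<notin> f"
  shows "relative_degree (Suc i) (insert f M) v = updated_degree i M v f"
proof -
  have "0 < expected_degree i"
    using assms(1) expected_degree_pos by (simp add: controlled_def)
  moreover have "real (degree (free_edges H (insert f M)) v) =
      real (degree (free_edges H M) v) - real (loss M v f)"
    using degree_insert[OF assms(2), of M] by linarith
  ultimately show ?thesis
    by (simp add: updated_degree_def relative_degree_def flip: diff_divide_distrib)
qed

lemma sum_cosh_updated_degree_le:
  assumes control: "controlled i" "near_regular i M" and M: "M \<in> matchings_of_size H i"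
    and v: "v \<in> uncovered M"
  shows "(\<Sum>f\<in>free_edges H M. cosh (\<theta> * (updated_degree i M v f - 1)))
    \<le> real (card (free_edges H M)) * cosh (\<theta> * (relative_degree i M v - 1)) *
      exp (9 * \<theta> * tolerance i * decay i)"
  unfolding updated_degree_def
proof (rule sum_cosh_drift_le[where c = "real k / expected_degree i"])
  have x: "0 < free_fraction i"
    using control(1) by (simp add: controlled_def)
  note d = expected_degree_pos[OF x]
  show "real (loss M v f) / expected_degree i \<le> real k / expected_degree i"
    if "f \<in> free_edges H M" for f
  proof -
    have "f \<in> H"
      using that free_edges_subset by blast
    then show ?thesis
      using loss_le[of f M v] card_edge[of f] d by (intro divide_right_mono) auto
  qed
  show "0 \<le> real (loss M v f) / expected_degree i" for f
    using d by simp
  show "decay i \<le> real k / expected_degree i"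
    by (rule decay_le[OF x])
  show "tolerance i \<le> 1 / 4"
    using control(1) by (simp add: controlled_def)
  show "0 \<le> \<theta>"
    using \<theta>_ge_1 by simp
qed (intro abs_sum_relative_loss_diff_le expected_degree_growth relative_degree_bounds
    controlled_bounds control M v)+

lemma potential_insert_le:
  assumes "controlled i"
  shows "potential (Suc i) (insert f M) \<le> 2 * exp (- (\<theta> * tolerance (Suc i))) *
    (\<Sum>v\<in>uncovered M. cosh (\<theta> * (updated_degree i M v f - 1)))"
proof -
  have "(\<Sum>v\<in>uncovered M - f. cosh (\<theta> * (relative_degree (Suc i) (insert f M) v - 1))) =
      (\<Sum>v\<in>uncovered M - f. cosh (\<theta> * (updated_degree i M v f - 1)))"
    by (intro sum.cong refl) (simp add: relative_degree_insert[OF assms])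
  also have "\<dots> \<le> (\<Sum>v\<in>uncovered M. cosh (\<theta> * (updated_degree i M v f - 1)))"
    by (intro sum_mono2) (auto simp: finite_uncovered)
  finally show ?thesis
    unfolding potential_def uncovered_insert by (intro mult_left_mono) auto
qed

lemma sum_potential_insert_le:
  assumes control: "controlled i" and small: "potential i M < 1" and M: "M \<in> matchings_of_size H i"
  shows "(\<Sum>f\<in>free_edges H M. potential (Suc i) (insert f M))
      \<le> real (card (free_edges H M)) * potential i M"
proof -
  define a where "a = real (card (free_edges H M))"
  define W where "W = 2 * exp (- (\<theta> * tolerance (Suc i)))"
  note near = near_regular_if_potential_less_1[OF small]
  have "(\<Sum>f\<in>free_edges H M. potential (Suc i) (insert f M))
      \<le> (\<Sum>f\<in>free_edges H M. W * (\<Sum>v\<in>uncovered M. cosh (\<theta> * (updated_degree i M v f - 1))))"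
    unfolding W_def by (intro sum_mono potential_insert_le control)
  also have "\<dots> = W * (\<Sum>v\<in>uncovered M. \<Sum>f\<in>free_edges H M. cosh (\<theta> * (updated_degree i M v f - 1)))"
    by (subst sum.swap) (simp add: sum_distrib_left)
  also have "\<dots> \<le> W * (\<Sum>v\<in>uncovered M.
      a * cosh (\<theta> * (relative_degree i M v - 1)) * exp (9 * \<theta> * tolerance i * decay i))"
    unfolding a_def W_def
    by (intro mult_left_mono sum_mono sum_cosh_updated_degree_le control near M) auto
  also have "\<dots> = a * (W * exp (9 * \<theta> * tolerance i * decay i) *
      (\<Sum>v\<in>uncovered M. cosh (\<theta> * (relative_degree i M v - 1))))"
    unfolding sum_distrib_right[symmetric] sum_distrib_left[symmetric] by simp
  also have "\<dots> \<le> a * potential i M"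
  proof -
    have "\<theta> * (tolerance i * (1 + 9 * decay i)) \<le> \<theta> * tolerance (Suc i)"
      using tolerance_Suc_ge[OF control] \<theta>_ge_1 by (intro mult_left_mono) auto
    then have "W * exp (9 * \<theta> * tolerance i * decay i) \<le> 2 * exp (- (\<theta> * tolerance i))"
      by (simp add: W_def algebra_simps flip: exp_add)
    then show ?thesis
      unfolding potential_def a_def by (intro mult_left_mono mult_right_mono sum_nonneg) auto
  qed
  finally show ?thesis
    by (simp add: a_def)
qed

end

section \<open>Lower bound for the number of matchings\<close>

lemma prod_le_fact_mult:
  fixes c w :: "nat \<Rightarrow> real"
  assumes "\<And>i. i < m \<Longrightarrow> 0 \<le> c i" "\<And>i. i < m \<Longrightarrow> c i * w i \<le> (real i + 1) * w (Suc i)"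
  shows "(\<Prod>i<m. c i) * w 0 \<le> fact m * w m"
  using assms
proof (induction m)
  case (Suc m)
  have "(\<Prod>i<Suc m. c i) * w 0 = c m * ((\<Prod>i<m. c i) * w 0)"
    by simp
  also have "\<dots> \<le> c m * (fact m * w m)"
    using Suc by (intro mult_left_mono) auto
  also have "\<dots> = fact m * (c m * w m)"
    by simp
  also have "\<dots> \<le> fact m * ((real m + 1) * w (Suc m))"
    using Suc.prems by (intro mult_left_mono) auto
  finally show ?case
    by (simp add: algebra_simps)
qed simp

lemma prod_1_minus_div: "(\<Prod>i<m. 1 - real i / real m) = fact m / real m ^ m"
proof -
  have "(\<Prod>i<m. 1 - real i / real m) = (\<Prod>i<m. real (m - i) / real m)"
    by (intro prod.cong) (auto simp: field_simps of_nat_diff)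
  also have "\<dots> = (\<Prod>i<m. real (m - i)) / real m ^ m"
    by (simp add: prod_dividef)
  also have "(\<Prod>i<m. real (m - i)) = fact m"
    by (simp add: fact_prod_rev atLeast0LessThan)
  finally show ?thesis .
qed

lemma power_le_exp_fact: "real m ^ m \<le> exp (real m) * fact m"
proof -
  have "real m ^ m /\<^sub>R fact m \<le> (\<Sum>j. real m ^ j /\<^sub>R fact j)"
    using sum_le_suminf[OF summable_exp_generic[of "real m"], of "{m}"] by simp
  then show ?thesis
    by (simp add: exp_def field_simps)
qed

lemma fact_mult_exp_power_le:
  assumes "real m \<le> P" "0 < k"
  shows "fact m * exp (1 - real k) ^ m \<le> P ^ m * (fact m / real m ^ m) ^ k"
proof -
  define q where "q = fact m / real m ^ m"
  have "0 < real m ^ m"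
    by (cases "m = 0") auto
  then have q: "0 \<le> q" "exp (- real m) \<le> q" "fact m = real m ^ m * q"
    using power_le_exp_fact[of m] by (auto simp: q_def exp_minus field_simps)
  have "exp (1 - real k) ^ m = exp (- real m) ^ (k - 1)"
    using assms(2) by (simp add: of_nat_diff algebra_simps flip: exp_of_nat_mult)
  then have "fact m * exp (1 - real k) ^ m = real m ^ m * (q * exp (- real m) ^ (k - 1))"
    using q(3) by simp
  also have "\<dots> \<le> P ^ m * (q * q ^ (k - 1))"
    using assms(1) q by (intro mult_mono power_mono mult_nonneg_nonneg zero_le_power) auto
  also have "q * q ^ (k - 1) = q ^ k"
    using assms(2) by (simp add: power_eq_if)
  finally show ?thesis
    by (simp add: q_def)
qed

context greedy_matching
begin

definition greedy_weight :: "nat \<Rightarrow> real" where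
  "greedy_weight i = (\<Sum>M\<in>matchings_of_size H i. max 0 (1 - potential i M))"

lemma greedy_weight_nonneg: "0 \<le> greedy_weight i"
  unfolding greedy_weight_def by (intro sum_nonneg) auto

lemma greedy_weight_le: "greedy_weight i \<le> real (card (matchings_of_size H i))"
proof -
  have "greedy_weight i \<le> (\<Sum>M\<in>matchings_of_size H i. 1)"
    unfolding greedy_weight_def using potential_nonneg by (intro sum_mono) auto
  then show ?thesis
    by simp
qed

lemma potential_0: "potential 0 {} = 2 * real (card V) * exp (- (\<theta> * \<epsilon>))"
  using D_pos
  by (simp add: potential_def uncovered_def relative_degree_def expected_degree_def tolerance_def
      free_fraction_def degree_eq)

lemma greedy_weight_0_ge:
  assumes "4 * real (card V) * exp (- (\<theta> * \<epsilon>)) \<le> 1"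
  shows "1 / 2 \<le> greedy_weight 0"
  using assms by (simp add: greedy_weight_def matchings_of_size_0 potential_0)

lemma greedy_weight_Suc:
  assumes control: "controlled i"
  shows "max_size * real D * free_fraction i ^ k * (1 - tolerance i) * greedy_weight i
    \<le> (real i + 1) * greedy_weight (Suc i)"
proof -
  let ?c = "max_size * real D * free_fraction i ^ k * (1 - tolerance i)"
  have c_eq: "?c = (max_size - real i) * expected_degree i * (1 - tolerance i)"
    using k_pos by (simp add: max_size_diff expected_degree_def power_eq_if)
  have "?c * max 0 (1 - potential i M)
      \<le> (\<Sum>f\<in>free_edges H M. max 0 (1 - potential (Suc i) (insert f M)))"
    if M: "M \<in> matchings_of_size H i" for M
  proof (cases "potential i M < 1")
    case True
    have "?c \<le> real (card (free_edges H M))"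
      using abs_card_free_edges_diff_le[OF control near_regular_if_potential_less_1[OF True] M]
      unfolding c_eq by (simp add: abs_le_iff algebra_simps)
    then have "?c * (1 - potential i M) \<le> real (card (free_edges H M)) * (1 - potential i M)"
      using True by (intro mult_right_mono) auto
    also have "\<dots> \<le> (\<Sum>f\<in>free_edges H M. 1 - potential (Suc i) (insert f M))"
      using sum_potential_insert_le[OF control True M] by (simp add: sum_subtractf algebra_simps)
    also have "\<dots> \<le> (\<Sum>f\<in>free_edges H M. max 0 (1 - potential (Suc i) (insert f M)))"
      by (intro sum_mono) auto
    finally show ?thesis
      using True by simp
  qed (auto intro: sum_nonneg)
  then have "?c * greedy_weight i
      \<le> (\<Sum>M\<in>matchings_of_size H i. \<Sum>f\<in>free_edges H M. max 0 (1 - potential (Suc i) (insert f M)))"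
    unfolding greedy_weight_def sum_distrib_left by (intro sum_mono)
  also have "\<dots> = (real i + 1) * greedy_weight (Suc i)"
    unfolding greedy_weight_def by (rule sum_free_edges_eq_sum_matchings_Suc)
  finally show ?thesis .
qed

lemma free_fraction_antimono: "i \<le> m \<Longrightarrow> free_fraction m \<le> free_fraction i"
  using max_size_pos by (simp add: free_fraction_def divide_right_mono)

lemma tolerance_mono:
  assumes "i \<le> m" "0 < free_fraction m"
  shows "tolerance i \<le> tolerance m"
proof -
  have "free_fraction m ^ (9 * k) \<le> free_fraction i ^ (9 * k)"
    using assms free_fraction_antimono by (intro power_mono) auto
  then show ?thesis
    unfolding tolerance_def using assms \<epsilon>_pos free_fraction_antimono[OF assms(1)]
    by (intro divide_left_mono mult_pos_pos zero_less_power) auto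
qed

lemma controlled_if_le:
  assumes "i \<le> m" and x: "0 < free_fraction m" and "tolerance m \<le> 1 / 4"
    and "9 * real k * \<theta> \<le> \<epsilon> * expected_degree m"
  shows "controlled i"
proof -
  have xi: "0 < free_fraction i" and tol_le: "tolerance i \<le> tolerance m"
    using free_fraction_antimono[OF assms(1)] tolerance_mono[OF assms(1)] x by auto
  have "free_fraction i ^ (9 * k) \<le> 1"
    using xi free_fraction_le_1 by (intro power_le_one) auto
  then have "\<epsilon> \<le> tolerance i"
    using \<epsilon>_pos xi by (simp add: tolerance_def le_divide_eq)
  moreover have "expected_degree m \<le> expected_degree i"
    unfolding expected_degree_def using x free_fraction_antimono[OF assms(1)]
    by (intro mult_left_mono power_mono) auto
  ultimately have "\<epsilon> * expected_degree m \<le> tolerance i * expected_degree i"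
    using \<epsilon>_pos expected_degree_pos[OF x] by (intro mult_mono) auto
  then show ?thesis
    using xi tol_le assms(3,4) by (simp add: controlled_def)
qed

lemma greedy_weight_Suc_uniform:
  assumes x: "0 < free_fraction m" and tol: "tolerance m \<le> 1 / 4"
    and large: "9 * real k * \<theta> \<le> \<epsilon> * expected_degree m" and "i < m"
  shows "max_size * (real D * (1 - tolerance m)) * (1 - real i / real m) ^ k * greedy_weight i
    \<le> (real i + 1) * greedy_weight (Suc i)"
proof -
  have "real m \<le> max_size"
    using x max_size_pos by (simp add: free_fraction_def)
  then have "1 - real i / real m \<le> free_fraction i"
    using \<open>i < m\<close> by (simp add: free_fraction_def frac_le)
  moreover have "tolerance i \<le> tolerance m"
    using \<open>i < m\<close> x by (intro tolerance_mono) auto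
  ultimately have "(1 - tolerance m) * (1 - real i / real m) ^ k
      \<le> (1 - tolerance i) * free_fraction i ^ k"
    using \<open>i < m\<close> tol by (intro mult_mono power_mono) auto
  then have "max_size * (real D * (1 - tolerance m)) * (1 - real i / real m) ^ k
      \<le> max_size * real D * free_fraction i ^ k * (1 - tolerance i)"
    using max_size_pos by (simp add: mult_left_mono ac_simps)
  then have "max_size * (real D * (1 - tolerance m)) * (1 - real i / real m) ^ k * greedy_weight i
      \<le> max_size * real D * free_fraction i ^ k * (1 - tolerance i) * greedy_weight i"
    by (rule mult_right_mono[OF _ greedy_weight_nonneg])
  also have "\<dots> \<le> (real i + 1) * greedy_weight (Suc i)"
    using \<open>i < m\<close> by (intro greedy_weight_Suc controlled_if_le[OF _ x tol large]) simp
  finally show ?thesis .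
qed

lemma card_matchings_of_size_ge:
  assumes x: "0 < free_fraction m" and tol: "tolerance m \<le> 1 / 4"
    and large: "9 * real k * \<theta> \<le> \<epsilon> * expected_degree m"
    and start: "4 * real (card V) * exp (- (\<theta> * \<epsilon>)) \<le> 1"
  shows "(real D * (1 - tolerance m) * exp (1 - real k)) ^ m
      \<le> 2 * real (card (matchings_of_size H m))"
proof -
  define E where "E = real D * (1 - tolerance m)"
  define c where "c i = max_size * E * (1 - real i / real m) ^ k" for i
  have E0: "0 \<le> E"
    using tol by (simp add: E_def)
  have m_le: "real m \<le> max_size"
    using x max_size_pos by (simp add: free_fraction_def)
  have "c i * greedy_weight i \<le> (real i + 1) * greedy_weight (Suc i)" if "i < m" for i
    unfolding c_def E_def by (rule greedy_weight_Suc_uniform[OF x tol large that])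
  moreover have "0 \<le> c i" if "i < m" for i
    using that E0 max_size_pos by (auto simp: c_def intro!: mult_nonneg_nonneg)
  ultimately have "(\<Prod>i<m. c i) * greedy_weight 0 \<le> fact m * greedy_weight m"
    by (intro prod_le_fact_mult)
  moreover have prod_c: "(\<Prod>i<m. c i) = E ^ m * (max_size ^ m * (fact m / real m ^ m) ^ k)"
    by (simp add: c_def prod.distrib prod_1_minus_div prod_power_distrib[symmetric]
        power_mult_distrib ac_simps)
  moreover have "(\<Prod>i<m. c i) * (1 / 2) \<le> (\<Prod>i<m. c i) * greedy_weight 0"
    unfolding prod_c using E0 max_size_pos greedy_weight_0_ge[OF start]
    by (intro mult_left_mono mult_nonneg_nonneg zero_le_power) auto
  moreover have "fact m * (E * exp (1 - real k)) ^ m \<le> (\<Prod>i<m. c i)"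
    unfolding prod_c power_mult_distrib
    using mult_left_mono[OF fact_mult_exp_power_le[OF m_le k_pos], of "E ^ m"] E0
    by (simp add: ac_simps)
  moreover have "fact m * greedy_weight m \<le> fact m * real (card (matchings_of_size H m))"
    by (intro mult_left_mono greedy_weight_le) auto
  ultimately have "fact m * (E * exp (1 - real k)) ^ m
      \<le> fact m * (2 * real (card (matchings_of_size H m)))"
    by linarith
  then show ?thesis
    by (simp add: E_def)
qed

lemma ln_card_matchings_ge_of_size:
  assumes "0 < free_fraction m" and tol: "tolerance m \<le> 1 / 4"
    and "9 * real k * \<theta> \<le> \<epsilon> * expected_degree m"
    and "4 * real (card V) * exp (- (\<theta> * \<epsilon>)) \<le> 1"
  shows "real m * (ln (real D) + 1 - real k + ln (1 - tolerance m)) - ln 2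
      \<le> ln (real (card (matchings H)))"
proof -
  have "(real D * (1 - tolerance m) * exp (1 - real k)) ^ m
      \<le> 2 * real (card (matchings_of_size H m))"
    by (rule card_matchings_of_size_ge[OF assms])
  also have "\<dots> \<le> 2 * real (card (matchings H))"
    using card_matchings_of_size_le by simp
  finally have "ln ((real D * (1 - tolerance m) * exp (1 - real k)) ^ m)
      \<le> ln (2 * real (card (matchings H)))"
    using tol D_pos by (intro ln_mono zero_less_power) auto
  moreover have "ln ((real D * (1 - tolerance m) * exp (1 - real k)) ^ m)
      = real m * (ln (real D) + 1 - real k + ln (1 - tolerance m))"
    using tol D_pos by (simp add: ln_realpow ln_mult)
  ultimately show ?thesis
    using card_matchings_pos by (simp add: ln_mult)
qed

end

section \<open>Entropy bound for the number of matchings\<close>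

lemma x_ln_x_ge_tangent:
  fixes c x :: real
  assumes "0 < c" "0 \<le> x"
  shows "x * ln c + x - c \<le> x * ln x"
proof (cases "x = 0")
  case False
  then have x: "0 < x"
    using assms by simp
  have "ln (c / x) \<le> c / x - 1"
    using assms x by (intro ln_le_minus_one) auto
  then have "x * ln (c / x) \<le> x * (c / x - 1)"
    using x by (intro mult_left_mono) auto
  then show ?thesis
    using assms x by (simp add: ln_div right_diff_distrib)
qed (use assms in simp)

lemma card_nsets: "finite A \<Longrightarrow> card (nsets A r) = card A choose r"
  using n_subsets[of A r] finite_subset[of _ A]
  by (auto simp: nsets_def cong: conj_cong intro: arg_cong[where f = card])

context hypergraph
begin

definition num_extensions :: "nat \<Rightarrow> 'v set set \<Rightarrow> nat" where
  "num_extensions m I = card {M \<in> matchings_of_size H m. I \<subseteq> M}"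

lemma sum_num_extensions_mult:
  fixes g :: "'v set set \<Rightarrow> real"
  shows "(\<Sum>I\<in>matchings_of_size H i. real (num_extensions m I) * g I) =
    (\<Sum>M\<in>matchings_of_size H m. \<Sum>I\<in>nsets M i. g I)"
proof -
  have "(\<Sum>I\<in>matchings_of_size H i. real (num_extensions m I) * g I)
      = (\<Sum>I\<in>matchings_of_size H i. \<Sum>M\<in>{M \<in> matchings_of_size H m. I \<subseteq> M}. g I)"
    by (simp add: num_extensions_def)
  also have "\<dots> = (\<Sum>M\<in>matchings_of_size H m. \<Sum>I\<in>{I \<in> matchings_of_size H i. I \<subseteq> M}. g I)"
    by (rule sum.swap_restrict) (rule finite_matchings_of_size)+
  also have "\<dots> = (\<Sum>M\<in>matchings_of_size H m. \<Sum>I\<in>nsets M i. g I)"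
    by (intro sum.cong refl)
       (auto simp: nsets_def dest: matchings_of_sizeD(3,4) subset_matching)
  finally show ?thesis .
qed

lemma sum_num_extensions:
  "(\<Sum>I\<in>matchings_of_size H i. real (num_extensions m I)) =
    real (card (matchings_of_size H m)) * real (m choose i)"
  using sum_num_extensions_mult[of m "\<lambda>_. 1" i] by (simp add: card_nsets matchings_of_sizeD(3,4))

lemma sum_num_extensions_insert:
  assumes I: "I \<in> matchings_of_size H i"
  shows "(\<Sum>f\<in>free_edges H I. num_extensions m (insert f I)) = (m - i) * num_extensions m I"
proof -
  let ?A = "{M \<in> matchings_of_size H m. I \<subseteq> M}"
  have "(\<Sum>f\<in>free_edges H I. num_extensions m (insert f I)) = (\<Sum>f\<in>free_edges H I. degree ?A f)"
    unfolding num_extensions_def degree_def by (intro sum.cong refl arg_cong[where f = card]) auto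
  also have "\<dots> = (\<Sum>M\<in>?A. card (M \<inter> free_edges H I))"
    by (rule sum_degree) (auto simp: finite_matchings_of_size finite_free_edges)
  also have "\<dots> = (\<Sum>M\<in>?A. m - i)"
  proof (intro sum.cong refl)
    fix M assume "M \<in> ?A"
    then have M: "M \<in> matchings_of_size H m" "I \<subseteq> M"
      by auto
    then have "card (M - I) = m - i"
      using matchings_of_sizeD[OF M(1)] matchings_of_sizeD[OF I] by (simp add: card_Diff_subset)
    then show "card (M \<inter> free_edges H I) = m - i"
      by (simp add: matching_Int_free_edges[OF M])
  qed
  finally show ?thesis
    by (simp add: num_extensions_def)
qed

lemma num_extensions_empty: "num_extensions m {} = card (matchings_of_size H m)"
  by (simp add: num_extensions_def)

lemma num_extensions_eq_1:
  assumes "I \<in> matchings_of_size H m"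
  shows "num_extensions m I = 1"
proof -
  have "M = I" if "M \<in> matchings_of_size H m" "I \<subseteq> M" for M
    using card_subset_eq[of M I] that matchings_of_sizeD(3)[OF assms]
      matchings_of_sizeD(3,4)[OF that(1)]
    by simp
  then have "{M \<in> matchings_of_size H m. I \<subseteq> M} = {I}"
    using assms by auto
  then show ?thesis
    by (simp add: num_extensions_def)
qed

lemma sum_num_extensions_insert_ln_ge:
  assumes I: "I \<in> matchings_of_size H i" and "i < m" and B: "0 < B"
  defines "n \<equiv> real (num_extensions m I)"
  shows "real (m - i) * (n * ln n + n * (ln (real (m - i) / B) + 1)
      - n * real (card (free_edges H I)) / B)
    \<le> (\<Sum>f\<in>free_edges H I. real (num_extensions m (insert f I))
        * ln (real (num_extensions m (insert f I))))"
proof (cases "num_extensions m I = 0")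
  case True
  have "0 \<le> real j * ln (real j)" for j
    by (cases "j = 0") auto
  then show ?thesis
    using True by (simp add: n_def sum_nonneg)
next
  case False
  define t where "t = real (m - i)"
  define c where "c = n * (t / B)"
  have pos: "0 < n" "0 < t" "0 < c"
    using False assms(2) B by (auto simp: n_def t_def c_def)
  have "(\<Sum>f\<in>free_edges H I. real (num_extensions m (insert f I))) = t * n"
    using arg_cong[OF sum_num_extensions_insert[OF I, of m], of real] by (simp add: t_def n_def)
  then have "(\<Sum>f\<in>free_edges H I. real (num_extensions m (insert f I)) * ln c
      + real (num_extensions m (insert f I)) - c)
          = t * n * (ln c + 1) - real (card (free_edges H I)) * c"
    by (simp add: sum.distrib sum_subtractf distrib_left flip: sum_distrib_right)
  moreover have "ln c = ln n + ln (t / B)"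
    unfolding c_def using pos B by (subst ln_mult) auto
  moreover have "(\<Sum>f\<in>free_edges H I. real (num_extensions m (insert f I)) * ln c
      + real (num_extensions m (insert f I)) - c)
      \<le> (\<Sum>f\<in>free_edges H I. real (num_extensions m (insert f I))
          * ln (real (num_extensions m (insert f I))))"
    by (intro sum_mono x_ln_x_ge_tangent pos) auto
  ultimately show ?thesis
    by (simp add: c_def algebra_simps flip: t_def)
qed

definition extension_entropy :: "nat \<Rightarrow> nat \<Rightarrow> real" where
  "extension_entropy m i =
    (\<Sum>I\<in>matchings_of_size H i. real (num_extensions m I) * ln (real (num_extensions m I)))
      / real (m choose i)"

lemma extension_entropy_Suc_ge:
  assumes i: "i < m" and B: "0 < B"
    and bound: "\<And>M. M \<in> matchings_of_size H m \<Longrightarrow>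
      (\<Sum>I\<in>nsets M i. real (card (free_edges H I))) \<le> real (m choose i) * B"
  shows "extension_entropy m i + real (card (matchings_of_size H m)) * ln (real (m - i) / B)
    \<le> extension_entropy m (Suc i)"
proof -
  define Z where "Z = real (card (matchings_of_size H m))"
  define C where "C = real (m choose i)"
  define t where "t = real (m - i)"
  define n where "n I = real (num_extensions m I)" for I
  define S where "S j = (\<Sum>I\<in>matchings_of_size H j. n I * ln (n I))" for j
  have pos: "0 < C" "0 < t"
    using i by (auto simp: C_def t_def)
  have "Suc i * (m choose Suc i) = (m - i) * (m choose i)"
    by (simp only: binomial_absorption binomial_absorb_comp)
  then have absorb: "(real i + 1) * real (m choose Suc i) = t * C"
    unfolding t_def C_def by (metis of_nat_Suc of_nat_mult add.commute)
  have "(\<Sum>I\<in>matchings_of_size H i. n I * real (card (free_edges H I)))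
      \<le> (\<Sum>M\<in>matchings_of_size H m. C * B)"
    unfolding n_def sum_num_extensions_mult C_def using bound by (rule sum_mono)
  then have "(\<Sum>I\<in>matchings_of_size H i. n I * real (card (free_edges H I)) / B) \<le> Z * C"
    using B by (simp add: Z_def field_simps flip: sum_divide_distrib)
  moreover have "(\<Sum>I\<in>matchings_of_size H i. n I * (ln (t / B) + 1)) = Z * C * (ln (t / B) + 1)"
    by (simp add: n_def sum_num_extensions Z_def C_def flip: sum_distrib_right)
  ultimately have "t * (S i + Z * C * ln (t / B)) \<le> t * (\<Sum>I\<in>matchings_of_size H i.
      n I * ln (n I) + n I * (ln (t / B) + 1) - n I * real (card (free_edges H I)) / B)"
    using pos by (intro mult_left_mono) (auto simp: S_def sum.distrib sum_subtractf algebra_simps)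
  also have "\<dots> \<le> (\<Sum>I\<in>matchings_of_size H i. \<Sum>f\<in>free_edges H I.
      n (insert f I) * ln (n (insert f I)))"
    unfolding sum_distrib_left n_def t_def by (intro sum_mono sum_num_extensions_insert_ln_ge i B)
  also have "\<dots> = (real i + 1) * S (Suc i)"
    unfolding S_def by (rule sum_free_edges_eq_sum_matchings_Suc)
  finally have "t * (S i + Z * C * ln (t / B)) / (t * C) \<le> (real i + 1) * S (Suc i) / (t * C)"
    using pos by (intro divide_right_mono) auto
  also have "\<dots> = extension_entropy m (Suc i)"
    by (simp add: extension_entropy_def S_def n_def flip: absorb)
  also have "t * (S i + Z * C * ln (t / B)) / (t * C) = extension_entropy m i + Z * ln (t / B)"
    using pos by (simp add: extension_entropy_def S_def n_def add_divide_distrib flip: C_def)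
  finally show ?thesis
    by (simp add: Z_def t_def)
qed

text \<open>Chain rule for the entropy of a uniformly random \<open>m\<close>-matching revealed edge by edge in random
  order: given the set \<open>I\<close> revealed so far, the next edge has at most \<open>card (free_edges H I)\<close>
  values.\<close>

lemma ln_card_matchings_of_size_le:
  fixes B :: "nat \<Rightarrow> real"
  assumes nonempty: "matchings_of_size H m \<noteq> {}" and B_pos: "\<And>i. i < m \<Longrightarrow> 0 < B i"
    and bound: "\<And>i M. i < m \<Longrightarrow> M \<in> matchings_of_size H m \<Longrightarrow>
      (\<Sum>I\<in>nsets M i. real (card (free_edges H I))) \<le> real (m choose i) * B i"
  shows "ln (real (card (matchings_of_size H m))) \<le> (\<Sum>i<m. ln (B i)) - ln (fact m)"
proof -
  define Z where "Z = real (card (matchings_of_size H m))"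
  have Z: "0 < Z"
    using nonempty finite_matchings_of_size by (simp add: Z_def card_gt_0_iff)
  have "(fact m :: real) = (\<Prod>i<m. real (m - i))"
    by (simp add: fact_prod_rev atLeast0LessThan)
  also have "ln \<dots> = (\<Sum>i<m. ln (real (m - i)))"
    by (rule ln_prod) auto
  finally have ln_fact: "ln (fact m) = (\<Sum>i<m. ln (real (m - i)))" .
  have "Z * ln Z = extension_entropy m 0 - extension_entropy m m"
    by (simp add: extension_entropy_def matchings_of_size_0 num_extensions_empty
        num_extensions_eq_1 Z_def)
  also have "\<dots> = (\<Sum>i<m. extension_entropy m i - extension_entropy m (Suc i))"
    by (simp add: sum_lessThan_telescope')
  also have "\<dots> \<le> (\<Sum>i<m. Z * (ln (B i) - ln (real (m - i))))"
  proof (intro sum_mono)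
    fix i assume "i \<in> {..<m}"
    then have i: "i < m"
      by simp
    have "ln (real (m - i) / B i) = ln (real (m - i)) - ln (B i)"
      using i B_pos[OF i] by (subst ln_div) auto
    then have "extension_entropy m i + Z * (ln (real (m - i)) - ln (B i))
        \<le> extension_entropy m (Suc i)"
      using extension_entropy_Suc_ge[OF i B_pos[OF i] bound[OF i]] by (simp only: Z_def)
    then show "extension_entropy m i - extension_entropy m (Suc i)
        \<le> Z * (ln (B i) - ln (real (m - i)))"
      by (simp add: algebra_simps)
  qed
  also have "\<dots> = Z * ((\<Sum>i<m. ln (B i)) - ln (fact m))"
    by (simp add: sum_subtractf ln_fact flip: sum_distrib_left)
  finally show ?thesis
    using Z by (simp add: Z_def)
qed

end

section \<open>Upper bound for the number of matchings\<close>

lemma binomial_pred_le: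
  fixes m n i :: nat
  assumes "0 < n" "n \<le> m"
  shows "real ((n - 1) choose i) \<le> real (n choose i) * (1 - real i / real m)"
proof (cases "i \<le> n")
  case True
  have "(n - i) * (n choose i) = n * ((n - 1) choose i)"
    by (rule binomial_absorb_comp)
  then have "real (n - i) * real (n choose i) = real n * real ((n - 1) choose i)"
    by (metis of_nat_mult)
  then have "real ((n - 1) choose i) = real (n choose i) * (1 - real i / real n)"
    using assms True by (simp add: field_simps of_nat_diff)
  also have "\<dots> \<le> real (n choose i) * (1 - real i / real m)"
    using assms by (intro mult_left_mono) (auto simp: frac_le)
  finally show ?thesis .
next
  case False
  then have "(n - 1) choose i = 0" "n choose i = 0"
    by (auto simp: binomial_eq_0)
  then show ?thesis
    by (simp only: of_nat_0 mult_zero_left order_refl)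
qed

lemma binomial_diff_le:
  fixes m i j :: nat
  assumes "i \<le> m" "j \<le> m"
  shows "real ((m - j) choose i) \<le> real (m choose i) * (1 - real i / real m) ^ j"
  using assms(2)
proof (induction j)
  case (Suc j)
  have x: "0 \<le> 1 - real i / real m"
    using assms(1) by (cases "m = 0") auto
  have "real ((m - Suc j) choose i) \<le> real ((m - j) choose i) * (1 - real i / real m)"
    using Suc.prems binomial_pred_le[of "m - j" m i] by simp
  also have "\<dots> \<le> real (m choose i) * (1 - real i / real m) ^ j * (1 - real i / real m)"
    using Suc x by (intro mult_right_mono) auto
  finally show ?case
    by (simp add: mult_ac)
qed simp

lemma power_add_le:
  fixes x y :: real
  assumes "0 \<le> x" "0 \<le> y" "0 < k"
  shows "x ^ k + y ^ k \<le> (x + y) ^ k"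
  using assms(3)
proof (induction k rule: nat_induct_non_zero)
  case (Suc k)
  have "x ^ Suc k + y ^ Suc k \<le> (x + y) * (x ^ k + y ^ k)"
    using assms by (simp add: algebra_simps)
  also have "\<dots> \<le> (x + y) * (x + y) ^ k"
    using Suc assms by (intro mult_left_mono) auto
  finally show ?case
    by simp
qed simp

lemma ln_fact_ge: "real m * ln (real m) - real m \<le> ln (fact m)"
proof (cases "m = 0")
  case False
  then have "ln (real m ^ m) \<le> ln (exp (real m) * fact m)"
    using power_le_exp_fact[of m] by (subst ln_le_cancel_iff) auto
  then show ?thesis
    using False by (simp add: ln_mult ln_realpow)
qed simp

text \<open>The integral of \<open>ln (x + b)\<close> over the unit interval is \<open>shift_cost b - 1\<close>.\<close>

definition shift_cost :: "real \<Rightarrow> real" where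
  "shift_cost b = (1 + b) * ln (1 + b) - b * ln b"

lemma sum_ln_Riemann_le:
  fixes b :: real
  assumes "0 < b"
  shows "(\<Sum>i<m. ln (real i / real m + b)) \<le> real m * (shift_cost b - 1)"
proof (cases "m = 0")
  case False
  define x where "x i = real i / real m + b" for i
  define F where "F i = x i * ln (x i) - x i" for i
  have x: "0 < x i" "x (Suc i) = x i + 1 / real m" for i
    using assms by (auto simp: x_def add_divide_distrib add_nonneg_pos)
  have "ln (x i) / real m \<le> F (Suc i) - F i" for i
    using x_ln_x_ge_tangent[of "x i" "x (Suc i)"] x(1)[of i] x(1)[of "Suc i"]
    by (simp add: F_def x(2) distrib_right)
  then have "(\<Sum>i<m. ln (x i) / real m) \<le> (\<Sum>i<m. F (Suc i) - F i)"
    by (rule sum_mono)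
  also have "\<dots> = shift_cost b - 1"
    unfolding sum_lessThan_telescope using False by (simp add: F_def x_def shift_cost_def)
  finally show ?thesis
    using False by (simp add: x_def field_simps flip: sum_divide_distrib)
qed simp

lemma sum_ln_reversed_Riemann_le:
  fixes a :: real
  assumes a: "0 < a" "1 \<le> a * real m"
  shows "(\<Sum>i<m. ln (1 - real i / real m + a)) \<le> real m * (shift_cost (2 * a) - 1)"
proof -
  have m: "0 < m"
    using a by (cases "m = 0") auto
  have "(\<Sum>i<m. ln (1 - real i / real m + a)) = (\<Sum>i<m. ln (1 - real (m - Suc i) / real m + a))"
    by (rule sum.nat_diff_reindex[symmetric])
  also have "\<dots> \<le> (\<Sum>i<m. ln (real i / real m + 2 * a))"
  proof (intro sum_mono)
    fix i assume "i \<in> {..<m}"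
    then have "1 - real (m - Suc i) / real m + a = real i / real m + a + 1 / real m"
      by (simp add: field_simps of_nat_diff)
    also have "\<dots> \<le> real i / real m + 2 * a"
      using a m by (simp add: field_simps)
    finally show "ln (1 - real (m - Suc i) / real m + a) \<le> ln (real i / real m + 2 * a)"
      using a(1) by (intro ln_mono add_nonneg_pos) (auto simp: divide_le_eq_1)
  qed
  also have "\<dots> \<le> real m * (shift_cost (2 * a) - 1)"
    using sum_ln_Riemann_le[of "2 * a" m] a by simp
  finally show ?thesis .
qed

lemma mult_ln_divide_le:
  fixes p q :: real
  assumes "0 < p" "0 \<le> q"
  shows "q * ln (p / q) \<le> p - q"
  using x_ln_x_ge_tangent[of p q] assms by (cases "q = 0") (auto simp: ln_div algebra_simps)

context regular_linear_hypergraph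
begin

lemma card_matching_edges_meeting_ge:
  assumes M: "M \<subseteq> H" and f: "f \<in> H" "f \<notin> M" "f \<subseteq> \<Union>M"
  shows "k \<le> card {e \<in> M. \<not> disjnt e f}"
proof -
  let ?B = "{e \<in> M. \<not> disjnt e f}"
  have finite: "finite ?B"
    using finite_subset[OF M finite_edges] by simp
  have "f = (\<Union>e\<in>?B. e \<inter> f)"
    using f(3) by (auto simp: disjnt_iff)
  then have "k = card (\<Union>e\<in>?B. e \<inter> f)"
    using card_edge[OF f(1)] by simp
  also have "\<dots> \<le> (\<Sum>e\<in>?B. card (e \<inter> f))"
    by (rule card_UN_le[OF finite])
  also have "\<dots> \<le> (\<Sum>e\<in>?B. 1)"
    using M f by (intro sum_mono card_Int_edges_le) auto
  finally show ?thesis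
    by simp
qed

lemma card_nsets_avoiding_edge_le:
  assumes M: "M \<in> matchings_of_size H m" and "i \<le> m" and f: "f \<in> H"
  shows "real (card {I \<in> nsets M i. f \<in> free_edges H I}) \<le>
    real (m choose i) * ((1 - real i / real m) ^ k + of_bool (f \<in> M \<or> \<not> f \<subseteq> \<Union>M))"
proof -
  define x where "x = 1 - real i / real m"
  have x: "0 \<le> x" "x \<le> 1"
    using assms(2) by (auto simp: x_def divide_le_eq_1)
  define B where "B = {e \<in> M. \<not> disjnt e f}"
  have M': "M \<subseteq> H" "finite M" "card M = m"
    using matchings_of_sizeD[OF M] by auto
  have B: "B \<subseteq> M" "finite B" "card B \<le> m"
    using M' by (auto simp: B_def intro: card_mono)
  have "{I \<in> nsets M i. f \<in> free_edges H I} = nsets (M - B) i"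
    using f by (auto simp: B_def nsets_def free_edges_def disjnt_iff)
  then have "real (card {I \<in> nsets M i. f \<in> free_edges H I}) = real ((m - card B) choose i)"
    using M' B by (simp add: card_nsets card_Diff_subset)
  also have "\<dots> \<le> real (m choose i) * x ^ card B"
    unfolding x_def using assms(2) B(3) by (rule binomial_diff_le)
  also have "\<dots> \<le> real (m choose i) * (x ^ k + of_bool (f \<in> M \<or> \<not> f \<subseteq> \<Union>M))"
  proof (intro mult_left_mono)
    show "x ^ card B \<le> x ^ k + of_bool (f \<in> M \<or> \<not> f \<subseteq> \<Union>M)"
    proof (cases "f \<in> M \<or> \<not> f \<subseteq> \<Union>M")
      case True
      then show ?thesis
        using x by (simp add: power_le_one add_increasing)
    next
      case False
      then have "k \<le> card B"
        unfolding B_def using M'(1) f by (intro card_matching_edges_meeting_ge) auto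
      then show ?thesis
        using False x by (simp add: power_decreasing)
    qed
  qed simp
  finally show ?thesis
    by (simp add: x_def)
qed

lemma card_edges_not_covered_le:
  assumes M: "M \<in> matchings_of_size H m"
  shows "card {f \<in> H. f \<in> M \<or> \<not> f \<subseteq> \<Union>M} \<le> m + D * card (uncovered M)"
proof -
  have "{f \<in> H. f \<in> M \<or> \<not> f \<subseteq> \<Union>M} \<subseteq> M \<union> (\<Union>v\<in>uncovered M. {f \<in> H. v \<in> f})"
    using edges_subset by (auto simp: uncovered_def)
  then have "card {f \<in> H. f \<in> M \<or> \<not> f \<subseteq> \<Union>M} \<le> card (M \<union> (\<Union>v\<in>uncovered M. {f \<in> H. v \<in> f}))"
    using matchings_of_sizeD(4)[OF M]
    by (intro card_mono) (auto simp: finite_uncovered finite_edges)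
  also have "\<dots> \<le> card M + (\<Sum>v\<in>uncovered M. degree H v)"
    unfolding degree_def
    by (rule order_trans[OF card_Un_le]) (intro add_left_mono card_UN_le finite_uncovered)
  also have "\<dots> = m + D * card (uncovered M)"
    using degree_eq matchings_of_sizeD(3)[OF M] by (simp add: uncovered_def)
  finally show ?thesis .
qed

lemma sum_card_free_edges_le:
  assumes M: "M \<in> matchings_of_size H m" and "i \<le> m"
  shows "(\<Sum>I\<in>nsets M i. real (card (free_edges H I))) \<le> real (m choose i) *
    (max_size * real D * ((1 - real i / real m) ^ k + real k * free_fraction m + 1 / real D))"
proof -
  define x where "x = 1 - real i / real m"
  have "(\<Sum>I\<in>nsets M i. card (free_edges H I)) = (\<Sum>I\<in>nsets M i. card {f \<in> H. f \<in> free_edges H I})"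
    using free_edges_subset by (intro sum.cong refl arg_cong[where f = card]) auto
  also have "\<dots> = (\<Sum>f\<in>H. card {I \<in> nsets M i. f \<in> free_edges H I})"
    using matchings_of_sizeD(4)[OF M] finite_edges
    by (intro sum_multicount_gen) (auto simp: finite_imp_finite_nsets)
  finally have "(\<Sum>I\<in>nsets M i. real (card (free_edges H I))) =
      (\<Sum>f\<in>H. real (card {I \<in> nsets M i. f \<in> free_edges H I}))"
    by (simp flip: of_nat_sum)
  also have "\<dots> \<le> (\<Sum>f\<in>H. real (m choose i) * (x ^ k + of_bool (f \<in> M \<or> \<not> f \<subseteq> \<Union>M)))"
    unfolding x_def by (intro sum_mono card_nsets_avoiding_edge_le M assms(2))
  also have "\<dots> = real (m choose i) *
      (real (card H) * x ^ k + real (card {f \<in> H. f \<in> M \<or> \<not> f \<subseteq> \<Union>M}))"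
    using finite_edges
    by (simp add: sum.distrib of_bool_def sum.If_cases Int_def flip: sum_distrib_left)
  also have "\<dots> \<le> real (m choose i) * (real (card H) * x ^ k +
      (max_size + real D * (real k * max_size * free_fraction m)))"
  proof (intro mult_left_mono add_left_mono)
    have "real (card {f \<in> H. f \<in> M \<or> \<not> f \<subseteq> \<Union>M}) \<le> real (m + D * card (uncovered M))"
      using card_edges_not_covered_le[OF M] by (rule of_nat_mono)
    then show "real (card {f \<in> H. f \<in> M \<or> \<not> f \<subseteq> \<Union>M})
        \<le> max_size + real D * (real k * max_size * free_fraction m)"
      using matching_size_le_max_size[OF M] by (simp add: card_uncovered_eq[OF M] card_vertices_eq)
  qed simp
  also have "\<dots> = real (m choose i) *
      (max_size * real D * (x ^ k + real k * free_fraction m + 1 / real D))"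
    using D_pos by (simp add: card_edges distrib_left ac_simps)
  finally show ?thesis
    by (simp add: x_def)
qed

lemma ln_card_matchings_of_size_le_all_edges:
  assumes "matchings_of_size H m \<noteq> {}"
  shows "ln (real (card (matchings_of_size H m))) \<le> max_size - real m + real m * (ln (real D) + 1)"
proof -
  have "(\<Sum>I\<in>nsets M i. real (card (free_edges H I))) \<le> real (m choose i) * (max_size * real D)"
    if M: "M \<in> matchings_of_size H m" for i M
  proof -
    have "(\<Sum>I\<in>nsets M i. real (card (free_edges H I))) \<le> real (card (nsets M i)) * real (card H)"
      using card_mono[OF finite_edges free_edges_subset] by (intro sum_bounded_above) simp
    then show ?thesis
      using matchings_of_sizeD[OF M] by (simp add: card_nsets card_edges)
  qed
  then have "ln (real (card (matchings_of_size H m)))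
      \<le> (\<Sum>i<m. ln (max_size * real D)) - ln (fact m)"
    using max_size_pos D_pos by (intro ln_card_matchings_of_size_le assms) auto
  also have "\<dots> \<le> real m * ln (max_size / real m) + real m * (ln (real D) + 1)"
    using ln_fact_ge[of m] max_size_pos D_pos
    by (cases "m = 0") (auto simp: ln_mult ln_div algebra_simps)
  finally show ?thesis
    using mult_ln_divide_le[OF max_size_pos, of "real m"] by simp
qed

lemma sum_card_free_edges_le_shifted:
  fixes a :: real
  assumes M: "M \<in> matchings_of_size H m" and "i \<le> m" and a: "0 \<le> a"
    and near_perfect: "real k * free_fraction m + 1 / real D \<le> a ^ k"
  shows "(\<Sum>I\<in>nsets M i. real (card (free_edges H I))) \<le>
    real (m choose i) * (max_size * real D * (1 - real i / real m + a) ^ k)"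
proof -
  have "(1 - real i / real m) ^ k + a ^ k \<le> (1 - real i / real m + a) ^ k"
    using \<open>i \<le> m\<close> a k_pos by (intro power_add_le) (auto simp: divide_le_eq_1)
  then have "max_size * real D * ((1 - real i / real m) ^ k + real k * free_fraction m + 1 / real D)
      \<le> max_size * real D * (1 - real i / real m + a) ^ k"
    using near_perfect max_size_pos by (intro mult_left_mono) auto
  then show ?thesis
    using sum_card_free_edges_le[OF M \<open>i \<le> m\<close>] by (meson mult_left_mono of_nat_0_le_iff order_trans)
qed

lemma ln_card_matchings_of_size_le_near_perfect:
  fixes a :: real
  assumes nonempty: "matchings_of_size H m \<noteq> {}" and a: "0 < a" "1 \<le> a * real m"
    and near_perfect: "real k * free_fraction m + 1 / real D \<le> a ^ k"
  shows "ln (real (card (matchings_of_size H m))) \<le>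
    max_size - real m + real m * (ln (real D) + 1 - real k + real k * shift_cost (2 * a))"
proof -
  define B where "B i = max_size * real D * (1 - real i / real m + a) ^ k" for i
  have m: "0 < m"
    using a by (cases "m = 0") auto
  have base_pos: "0 < 1 - real i / real m + a" if "i < m" for i
    using that a(1) by (intro add_nonneg_pos) auto
  have "(\<Sum>I\<in>nsets M i. real (card (free_edges H I))) \<le> real (m choose i) * B i"
    if "i < m" "M \<in> matchings_of_size H m" for i M
    unfolding B_def using that a(1) near_perfect by (intro sum_card_free_edges_le_shifted) auto
  then have "ln (real (card (matchings_of_size H m))) \<le> (\<Sum>i<m. ln (B i)) - ln (fact m)"
    using max_size_pos D_pos base_pos
    by (intro ln_card_matchings_of_size_le nonempty) (auto simp: B_def)
  also have "(\<Sum>i<m. ln (B i)) =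
      (\<Sum>i<m. ln (max_size * real D) + real k * ln (1 - real i / real m + a))"
  proof (intro sum.cong refl)
    fix i assume "i \<in> {..<m}"
    then show "ln (B i) = ln (max_size * real D) + real k * ln (1 - real i / real m + a)"
      using max_size_pos D_pos base_pos[of i] by (simp add: B_def ln_mult ln_realpow)
  qed
  also have "\<dots> = real m * ln (max_size * real D) + real k * (\<Sum>i<m. ln (1 - real i / real m + a))"
    by (simp add: sum.distrib sum_distrib_left)
  also have "(\<Sum>i<m. ln (1 - real i / real m + a)) \<le> real m * (shift_cost (2 * a) - 1)"
    using a by (rule sum_ln_reversed_Riemann_le)
  finally have "ln (real (card (matchings_of_size H m))) \<le>
      real m * ln (max_size * real D) + real k * (real m * (shift_cost (2 * a) - 1))
        - (real m * ln (real m) - real m)"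
    using ln_fact_ge[of m] by (simp add: mult_left_mono add_mono)
  also have "\<dots> = real m * ln (max_size / real m)
      + real m * (ln (real D) + 1 - real k + real k * shift_cost (2 * a))"
    using max_size_pos D_pos m by (simp add: ln_mult ln_div algebra_simps)
  finally show ?thesis
    using mult_ln_divide_le[OF max_size_pos, of "real m"] by simp
qed

end

section \<open>Asymptotics of the number of matchings\<close>

lemma shift_cost_nonneg:
  assumes "0 < b" "b \<le> 1"
  shows "0 \<le> shift_cost b"
proof -
  have "0 \<le> (1 + b) * ln (1 + b)" "b * ln b \<le> 0"
    using assms by (auto intro!: mult_nonneg_nonneg mult_nonneg_nonpos)
  then show ?thesis
    by (simp add: shift_cost_def)
qed

lemma shift_cost_small:
  fixes c \<eta> :: real
  assumes "0 < \<eta>"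
  obtains a where "0 < a" "a \<le> 1 / 2" "c * shift_cost (2 * a) \<le> \<eta>"
proof -
  have "((\<lambda>a. c * shift_cost (2 * a)) \<longlongrightarrow> 0) (at_right 0)"
    unfolding shift_cost_def by real_asymp
  then have "\<forall>\<^sub>F a in at_right 0. c * shift_cost (2 * a) < \<eta>"
    using assms by (rule order_tendstoD(2))
  moreover have "\<forall>\<^sub>F a :: real in at_right 0. 0 < a" "\<forall>\<^sub>F a :: real in at_right 0. a \<le> 1 / 2"
    by real_asymp+
  ultimately have "\<forall>\<^sub>F a in at_right 0. 0 < a \<and> a \<le> 1 / 2 \<and> c * shift_cost (2 * a) \<le> \<eta>"
    by eventually_elim auto
  then show ?thesis
    using that eventually_happens'[of "at_right (0 :: real)"] by auto
qed

context regular_linear_hypergraph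
begin

lemma max_size_gt: "real D / 2 < max_size"
proof -
  have "D * k \<le> D * (2 * (k - 1))"
    using k_ge_2 by (intro mult_left_mono) auto
  also have "\<dots> < 2 * card V"
    using card_vertices_gt by (simp add: ac_simps)
  finally have "real (D * k) < real (2 * card V)"
    by (rule of_nat_less_iff[THEN iffD2])
  then have "real k * real D < real k * (2 * max_size)"
    by (simp add: card_vertices_eq ac_simps)
  then show ?thesis
    using k_pos by simp
qed

lemma near_perfect_matching_size_ge:
  fixes a :: real
  assumes m: "real m \<le> max_size" and a: "0 < a" "a \<le> 1 / 2"
    and near_perfect: "real k * free_fraction m + 1 / real D \<le> a ^ k"
  shows "real D / 4 \<le> real m"
proof -
  have "a ^ k \<le> a"
    using power_decreasing[of 1 k a] a k_pos by simp
  moreover have "2 * free_fraction m \<le> real k * free_fraction m"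
    using m max_size_pos k_ge_2 by (intro mult_right_mono) (auto simp: free_fraction_def)
  moreover have "0 \<le> 1 / real D"
    by simp
  ultimately have "free_fraction m \<le> 1 / 4"
    using near_perfect a(2) by linarith
  then have "max_size / 2 \<le> real m"
    using max_size_pos by (simp add: free_fraction_def field_simps)
  then show ?thesis
    using max_size_gt by linarith
qed

lemma free_fraction_mult_ln_ge:
  fixes c :: real
  assumes "c \<le> real k * free_fraction m + 1 / real D" and "1 \<le> real D"
    and "(real k)\<^sup>2 \<le> (c - 1 / real D) * ln (real D)"
  shows "real k \<le> free_fraction m * ln (real D)"
proof -
  have "(c - 1 / real D) * ln (real D) \<le> real k * free_fraction m * ln (real D)"
    using assms(1,2) by (intro mult_right_mono) auto
  then have "real k * real k \<le> real k * (free_fraction m * ln (real D))"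
    using assms(3) by (simp add: power2_eq_square)
  then show ?thesis
    using k_pos by simp
qed

lemma ln_card_matchings_of_size_le_uniform:
  fixes a :: real
  assumes nonempty: "matchings_of_size H m \<noteq> {}" and a: "0 < a" "a \<le> 1 / 2"
    and large: "real k \<le> ln (real D)" "4 \<le> a * real D"
      "(real k)\<^sup>2 \<le> (a ^ k - 1 / real D) * ln (real D)"
  shows "ln (real (card (matchings_of_size H m))) \<le>
    max_size * (ln (real D) + 1 - real k + real k * shift_cost (2 * a))"
proof -
  define s where "s = real k * shift_cost (2 * a)"
  have s: "0 \<le> s"
    using a shift_cost_nonneg[of "2 * a"] by (simp add: s_def)
  have m_le: "real m \<le> max_size"
    using nonempty matching_size_le_max_size by blast
  show ?thesis
  proof (cases "real k * free_fraction m + 1 / real D \<le> a ^ k")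
    case True
    have "real D / 4 \<le> real m"
      by (rule near_perfect_matching_size_ge[OF m_le a True])
    then have "a * (real D / 4) \<le> a * real m"
      using a by (intro mult_left_mono) auto
    then have "1 \<le> a * real m"
      using large(2) by simp
    then have "ln (real (card (matchings_of_size H m)))
        \<le> max_size - real m + real m * (ln (real D) + 1 - real k + s)"
      unfolding s_def using a(1) True
      by (intro ln_card_matchings_of_size_le_near_perfect nonempty) auto
    also have "\<dots> = max_size * (ln (real D) + 1 - real k + s)
        - (max_size - real m) * (ln (real D) - real k + s)"
      by (simp add: algebra_simps)
    also have "\<dots> \<le> max_size * (ln (real D) + 1 - real k + s)"
      using m_le large(1) s by simp
    finally show ?thesis
      by (simp add: s_def)
  next
    case False
    then have k_le: "real k \<le> free_fraction m * ln (real D)"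
      using D_pos large(3) by (intro free_fraction_mult_ln_ge[of "a ^ k"]) auto
    have "ln (real (card (matchings_of_size H m))) \<le> max_size - real m + real m * (ln (real D) + 1)"
      by (rule ln_card_matchings_of_size_le_all_edges[OF nonempty])
    also have "\<dots> = max_size * (ln (real D) + 1 - free_fraction m * ln (real D))"
      using max_size_pos by (simp add: free_fraction_def field_simps)
    also have "\<dots> \<le> max_size * (ln (real D) + 1 - real k + s)"
      using k_le s max_size_pos by (intro mult_left_mono) auto
    finally show ?thesis
      by (simp add: s_def)
  qed
qed

lemma ln_card_matchings_le:
  fixes a :: real
  assumes "0 < a" "a \<le> 1 / 2" "real k \<le> ln (real D)" "4 \<le> a * real D"
    "(real k)\<^sup>2 \<le> (a ^ k - 1 / real D) * ln (real D)"
  shows "ln (real (card (matchings H))) \<le> ln (real (card V) + 1) +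
    max_size * (ln (real D) + 1 - real k + real k * shift_cost (2 * a))"
proof -
  define R where "R = max_size * (ln (real D) + 1 - real k + real k * shift_cost (2 * a))"
  have "real (card (matchings_of_size H m)) \<le> exp R" for m
  proof (cases "matchings_of_size H m = {}")
    case False
    then have "0 < real (card (matchings_of_size H m))"
      using finite_matchings_of_size by (simp add: card_gt_0_iff)
    moreover have "ln (real (card (matchings_of_size H m))) \<le> R"
      unfolding R_def using False assms by (rule ln_card_matchings_of_size_le_uniform)
    ultimately show ?thesis
      by (metis exp_le_cancel_iff exp_ln)
  qed simp
  then have "(\<Sum>m\<le>card V. real (card (matchings_of_size H m))) \<le> (\<Sum>m\<le>card V. exp R)"
    by (intro sum_mono)
  moreover have "real (card (matchings H)) \<le> real (\<Sum>m\<le>card V. card (matchings_of_size H m))"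
    unfolding matchings_eq_UN_matchings_of_size of_nat_le_iff by (rule card_UN_le) simp
  ultimately have "real (card (matchings H)) \<le> (real (card V) + 1) * exp R"
    by (simp add: add.commute)
  then have "ln (real (card (matchings H))) \<le> ln ((real (card V) + 1) * exp R)"
    using card_matchings_pos by (intro ln_mono) auto
  then show ?thesis
    by (simp add: ln_mult R_def add_nonneg_pos)
qed

lemma ln_card_matchings_ge:
  fixes \<delta> \<epsilon> \<theta> :: real
  defines "L \<equiv> ln (real D) + 1 - real k + ln (1 - \<epsilon> / \<delta> ^ (9 * k))"
  assumes \<delta>: "0 < \<delta>" "\<delta> \<le> 1" and \<epsilon>: "0 < \<epsilon>" "\<epsilon> / \<delta> ^ (9 * k) \<le> 1 / 4"
    and \<theta>: "1 \<le> \<theta>" "9 * real k * \<theta> \<le> \<epsilon> * (real D * \<delta> ^ (k - 1))"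
    and start: "4 * real (card V) * exp (- (\<theta> * \<epsilon>)) \<le> 1" and L: "0 \<le> L"
  shows "((1 - \<delta>) * max_size - 1) * L - ln 2 \<le> ln (real (card (matchings H)))"
proof -
  interpret greedy_matching V H k D \<epsilon> \<theta>
    by unfold_locales (use \<epsilon> \<theta> in auto)
  define m where "m = nat \<lfloor>(1 - \<delta>) * max_size\<rfloor>"
  have "0 \<le> (1 - \<delta>) * max_size"
    using \<delta> max_size_pos by simp
  then have m: "real m \<le> (1 - \<delta>) * max_size" "(1 - \<delta>) * max_size - 1 \<le> real m"
    unfolding m_def by linarith+
  have x: "\<delta> \<le> free_fraction m"
    using m(1) max_size_pos by (simp add: free_fraction_def field_simps)
  have tol_le: "tolerance m \<le> \<epsilon> / \<delta> ^ (9 * k)"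
    unfolding tolerance_def using x \<delta> \<epsilon> by (intro divide_left_mono power_mono mult_pos_pos) auto
  then have tol: "tolerance m \<le> 1 / 4"
    using \<epsilon>(2) by linarith
  have "\<delta> ^ (k - 1) \<le> free_fraction m ^ (k - 1)"
    using x \<delta> by (intro power_mono) auto
  then have "\<epsilon> * (real D * \<delta> ^ (k - 1)) \<le> \<epsilon> * expected_degree m"
    unfolding expected_degree_def using \<epsilon> by (intro mult_left_mono) auto
  then have count: "real m * (ln (real D) + 1 - real k + ln (1 - tolerance m)) - ln 2
      \<le> ln (real (card (matchings H)))"
    using x \<delta> tol \<theta>(2) start by (intro ln_card_matchings_ge_of_size) auto
  have "((1 - \<delta>) * max_size - 1) * L \<le> real m * L"
    using m(2) L by (rule mult_right_mono)
  also have "\<dots> \<le> real m * (ln (real D) + 1 - real k + ln (1 - tolerance m))"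
  proof -
    have "ln (1 - \<epsilon> / \<delta> ^ (9 * k)) \<le> ln (1 - tolerance m)"
      using tol_le \<epsilon>(2) by (intro ln_mono) linarith+
    then show ?thesis
      by (simp add: L_def mult_left_mono)
  qed
  finally show ?thesis
    using count by linarith
qed

end

lemma mult_power_le_exp:
  fixes a x y :: real
  assumes "0 < a" "0 < x" "ln a + real c * ln x \<le> y"
  shows "a * x ^ c \<le> exp y"
proof -
  have "a * x ^ c = exp (ln a + real c * ln x)"
    using assms(1,2) by (simp add: exp_add exp_of_nat_mult)
  then show ?thesis
    using assms(3) by simp
qed

lemma powr_minus_power_bounds:
  fixes x :: real
  assumes x: "1 < x" and k: "0 < k"
  defines "\<delta> \<equiv> x powr (- (1 / (72 * real k)))"
  shows "0 < \<delta>" "\<delta> \<le> 1" "\<delta> ^ (9 * k) = x powr (- 1 / 8)"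
    "x powr (5 / 8) \<le> x powr (- 1 / 4) * (x * \<delta> ^ (k - 1))"
proof -
  have "x powr (- (1 / (72 * real k))) \<le> x powr 0"
    using x by (intro powr_mono) auto
  then show \<delta>: "0 < \<delta>" "\<delta> \<le> 1"
    using x by (auto simp: \<delta>_def)
  show power_eq: "\<delta> ^ (9 * k) = x powr (- 1 / 8)"
    using x k by (simp add: \<delta>_def powr_power)
  have "x powr (5 / 8) = x powr (- 1 / 4) * (x * x powr (- 1 / 8))"
    using x by (simp add: powr_mult_base flip: powr_add)
  also have "\<dots> \<le> x powr (- 1 / 4) * (x * \<delta> ^ (k - 1))"
    unfolding power_eq[symmetric] using x \<delta> by (intro mult_left_mono power_decreasing) auto
  finally show "x powr (5 / 8) \<le> x powr (- 1 / 4) * (x * \<delta> ^ (k - 1))" .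
qed

context regular_linear_hypergraph
begin

text \<open>Stopping after \<open>\<lfloor>(1 - \<delta>) * max_size\<rfloor>\<close> edges costs only a lower order term.\<close>

lemma max_size_mult_le_truncated:
  fixes \<delta> L :: real
  assumes \<delta>: "0 \<le> \<delta>" and L: "L \<le> ln (real D)"
  shows "max_size * (L - (\<delta> + 2 / real D) * ln (real D) - 2 * ln 2 / real D)
    \<le> ((1 - \<delta>) * max_size - 1) * L - ln 2"
proof -
  have "1 \<le> max_size * (2 / real D)"
    using max_size_gt D_pos by (simp add: field_simps)
  then have "1 * ln (real D) \<le> max_size * (2 / real D) * ln (real D)"
    "1 * ln 2 \<le> max_size * (2 / real D) * ln 2"
    using D_pos by (intro mult_right_mono; simp)+
  moreover have "\<delta> * max_size * L \<le> \<delta> * max_size * ln (real D)"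
    using \<delta> L max_size_pos by (intro mult_left_mono) auto
  ultimately show ?thesis
    using L by (simp add: algebra_simps)
qed

lemma ln_card_matchings_ge_powr:
  fixes \<eta> :: real and c :: nat
  defines "x \<equiv> real D"
  defines "\<delta> \<equiv> x powr (- (1 / (72 * real k)))" and "l \<equiv> ln (1 - x powr (- 1 / 8))"
  assumes V: "real (card V) \<le> x ^ c" and x: "1 < x" "x powr (- 1 / 8) \<le> 1 / 4"
    "9 * real k * x powr (1 / 2) \<le> x powr (5 / 8)" "ln 4 + real c * ln x \<le> x powr (1 / 4)"
    and nonneg: "0 \<le> ln x + 1 - real k + l"
    and \<eta>: "(\<delta> + 2 / x) * ln x + 2 * ln 2 / x - l \<le> \<eta>"
  shows "max_size * (ln x + 1 - real k - \<eta>) \<le> ln (real (card (matchings H)))"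
proof -
  define L where "L = ln x + 1 - real k + l"
  note \<delta> = powr_minus_power_bounds[OF x(1) k_pos, folded \<delta>_def]
  have degree_ge: "9 * real k * x powr (1 / 2) \<le> x powr (- 1 / 4) * (x * \<delta> ^ (k - 1))"
    using x(3) \<delta>(4) by simp
  have tol_eq: "x powr (- 1 / 4) / \<delta> ^ (9 * k) = x powr (- 1 / 8)"
    by (simp add: \<delta>(3) flip: powr_diff)
  have "4 * x ^ c \<le> exp (x powr (1 / 2) * x powr (- 1 / 4))"
    using x(1,4) by (intro mult_power_le_exp) (auto simp flip: powr_add)
  then have "4 * real (card V) \<le> exp (x powr (1 / 2) * x powr (- 1 / 4))"
    using V by linarith
  then have "4 * real (card V) * exp (- (x powr (1 / 2) * x powr (- 1 / 4))) \<le> 1"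
    by (simp add: exp_minus divide_simps)
  then have "((1 - \<delta>) * max_size - 1) * L - ln 2 \<le> ln (real (card (matchings H)))"
    unfolding L_def l_def
    by (intro ln_card_matchings_ge[of \<delta> "x powr (- 1 / 4)" "x powr (1 / 2)",
          unfolded tol_eq, folded x_def])
       (use \<delta>(1,2) x nonneg degree_ge in \<open>auto simp: l_def ge_one_powr_ge_zero\<close>)
  moreover have "max_size * (L - (\<delta> + 2 / x) * ln x - 2 * ln 2 / x)
      \<le> ((1 - \<delta>) * max_size - 1) * L - ln 2"
  proof -
    have "l \<le> 0"
      using x(1,2) by (simp add: l_def)
    then show ?thesis
      unfolding x_def using \<delta>(1) k_ge_2
      by (intro max_size_mult_le_truncated) (auto simp: L_def x_def)
  qed
  moreover have "max_size * (ln x + 1 - real k - \<eta>)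
      \<le> max_size * (L - (\<delta> + 2 / x) * ln x - 2 * ln 2 / x)"
    using \<eta> max_size_pos by (intro mult_left_mono) (auto simp: L_def)
  ultimately show ?thesis
    by linarith
qed

lemma ln_card_vertices_Suc_le:
  assumes "real (card V) \<le> real D ^ c"
  shows "ln (real (card V) + 1) \<le> ln 2 + real c * ln (real D)"
proof -
  have "1 \<le> real D ^ c"
    using D_pos by (intro one_le_power) simp
  then have "real (card V) + 1 \<le> 2 * real D ^ c"
    using assms by linarith
  then have "ln (real (card V) + 1) \<le> ln (2 * real D ^ c)"
    by (intro ln_mono) auto
  also have "\<dots> = ln 2 + real c * ln (real D)"
    using D_pos by (simp add: ln_mult ln_realpow)
  finally show ?thesis .
qed

lemma ln_card_matchings_le_relative:
  fixes a \<eta> :: real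
  assumes V: "real (card V) \<le> real D ^ c"
    and a: "0 < a" "a \<le> 1 / 2" "real k * shift_cost (2 * a) \<le> \<eta> / 2"
    and D: "real k \<le> ln (real D)" "4 \<le> a * real D" "(real k)\<^sup>2 \<le> (a ^ k - 1 / real D) * ln (real D)"
      "ln 2 + real c * ln (real D) \<le> \<eta> / 4 * real D"
    and \<eta>: "0 < \<eta>"
  shows "ln (real (card (matchings H))) \<le> max_size * (ln (real D) + 1 - real k + \<eta>)"
proof -
  have "ln (real (card V) + 1) \<le> ln 2 + real c * ln (real D)"
    by (rule ln_card_vertices_Suc_le[OF V])
  also have "\<dots> \<le> \<eta> / 2 * (real D / 2)"
    using D(4) by simp
  also have "\<dots> \<le> \<eta> / 2 * max_size"
    using max_size_gt \<eta> by (intro mult_left_mono) auto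
  finally have "ln (real (card V) + 1) \<le> max_size * (\<eta> / 2)"
    by (simp add: mult.commute)
  moreover have "max_size * (real k * shift_cost (2 * a)) \<le> max_size * (\<eta> / 2)"
    using a(3) max_size_pos by (intro mult_left_mono) auto
  ultimately show ?thesis
    using ln_card_matchings_le[OF a(1,2) D(1-3)] by (simp add: algebra_simps)
qed

end

lemma eventually_ln_card_matchings_ge:
  fixes \<eta> :: real
  assumes \<eta>: "0 < \<eta>" and k: "2 \<le> k"
  shows "\<forall>\<^sub>F D in sequentially. \<forall>(V :: 'v set) H. regular_linear_hypergraph V H k D \<longrightarrow>
    real (card V) \<le> real D ^ c \<longrightarrow>
    real (card V) / real k * (ln (real D) + 1 - real k - \<eta>) \<le> ln (real (card (matchings H)))"
proof -
  have pos: "0 < 1 / (72 * real k)" "0 < real k"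
    using k by auto
  have "((\<lambda>D. (real D powr (- (1 / (72 * real k))) + 2 / real D) * ln (real D)
      + 2 * ln 2 / real D - ln (1 - real D powr (- 1 / 8))) \<longlongrightarrow> 0) sequentially"
    using pos(1) by real_asymp
  then have "\<forall>\<^sub>F D in sequentially. (real D powr (- (1 / (72 * real k))) + 2 / real D) * ln (real D)
      + 2 * ln 2 / real D - ln (1 - real D powr (- 1 / 8)) < \<eta>"
    using \<eta> by (rule order_tendstoD(2))
  moreover have "\<forall>\<^sub>F D in sequentially. 1 < real D"
    "\<forall>\<^sub>F D in sequentially. real D powr (- 1 / 8) \<le> 1 / 4"
    by real_asymp+
  moreover have "\<forall>\<^sub>F D in sequentially. 9 * real k * real D powr (1 / 2) \<le> real D powr (5 / 8)"
    "\<forall>\<^sub>F D in sequentially. ln 4 + real c * ln (real D) \<le> real D powr (1 / 4)"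
    "\<forall>\<^sub>F D in sequentially. 0 \<le> ln (real D) + 1 - real k + ln (1 - real D powr (- 1 / 8))"
    using pos(2) by real_asymp+
  ultimately show ?thesis
  proof eventually_elim
    case (elim D)
    show ?case
    proof (intro allI impI)
      fix V :: "'v set" and H
      assume "regular_linear_hypergraph V H k D" and V: "real (card V) \<le> real D ^ c"
      then interpret regular_linear_hypergraph V H k D
        by simp
      show "real (card V) / real k * (ln (real D) + 1 - real k - \<eta>)
          \<le> ln (real (card (matchings H)))"
        using ln_card_matchings_ge_powr[OF V] elim by (simp add: max_size_def)
    qed
  qed
qed

lemma eventually_ln_card_matchings_le:
  fixes \<eta> :: real
  assumes \<eta>: "0 < \<eta>"
  shows "\<forall>\<^sub>F D in sequentially. \<forall>(V :: 'v set) H. regular_linear_hypergraph V H k D \<longrightarrow>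
    real (card V) \<le> real D ^ c \<longrightarrow>
    ln (real (card (matchings H))) \<le> real (card V) / real k * (ln (real D) + 1 - real k + \<eta>)"
proof -
  obtain a where a: "0 < a" "a \<le> 1 / 2" "real k * shift_cost (2 * a) \<le> \<eta> / 2"
    using shift_cost_small[of "\<eta> / 2" "real k"] \<eta> by auto
  define b where "b = a ^ k"
  have b: "0 < b"
    using a(1) by (simp add: b_def)
  have "\<forall>\<^sub>F D in sequentially. ln 2 + real c * ln (real D) \<le> \<eta> / 4 * real D"
    using \<eta> by real_asymp
  moreover have "\<forall>\<^sub>F D in sequentially. real k \<le> ln (real D)"
    by real_asymp
  moreover have "\<forall>\<^sub>F D in sequentially. 4 \<le> a * real D"
    using a(1) by real_asymp
  moreover have "\<forall>\<^sub>F D in sequentially. (real k)\<^sup>2 \<le> (b - 1 / real D) * ln (real D)"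
    using b by real_asymp
  ultimately show ?thesis
  proof eventually_elim
    case (elim D)
    show ?case
    proof (intro allI impI)
      fix V :: "'v set" and H
      assume "regular_linear_hypergraph V H k D" and V: "real (card V) \<le> real D ^ c"
      then interpret regular_linear_hypergraph V H k D
        by simp
      show "ln (real (card (matchings H)))
          \<le> real (card V) / real k * (ln (real D) + 1 - real k + \<eta>)"
        using ln_card_matchings_le_relative[OF V a] elim \<eta> by (simp add: max_size_def b_def)
    qed
  qed
qed

section \<open>Sparse paving matroids and stable sets of the Johnson graph\<close>

definition johnson_stable_sets :: "'a set \<Rightarrow> nat \<Rightarrow> 'a set set set" where
  "johnson_stable_sets E r = {C. C \<subseteq> nsets E r \<and> pairwise (\<lambda>S T. card (S \<inter> T) < r - 1) C}"

definition nonbases :: "'a set \<Rightarrow> nat \<Rightarrow> 'a set set \<Rightarrow> 'a set set" where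
  "nonbases E r \<I> = nsets E r - \<I>"

definition indep_of_nonbases :: "'a set \<Rightarrow> nat \<Rightarrow> 'a set set \<Rightarrow> 'a set set" where
  "indep_of_nonbases E r C = {X. X \<subseteq> E \<and> card X \<le> r} - C"

text \<open>This is the closure of \<open>F\<close> in the matroid only if \<open>F\<close> is independent.\<close>

definition indep_closure :: "'a set \<Rightarrow> 'a set set \<Rightarrow> 'a set \<Rightarrow> 'a set" where
  "indep_closure E \<I> F = F \<union> {x \<in> E. insert x F \<notin> \<I>}"

lemma rank_of_ge:
  assumes "finite X" "Y \<in> \<I>" "Y \<subseteq> X"
  shows "card Y \<le> rank_of \<I> X"
  unfolding rank_of_def
  by (rule Max_ge) (use assms in \<open>auto intro: finite_subset[of _ "Pow X"]\<close>)

lemma rank_of_attained: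
  assumes "finite X" "{} \<in> \<I>"
  obtains Y where "Y \<in> \<I>" "Y \<subseteq> X" "card Y = rank_of \<I> X"
proof -
  have "rank_of \<I> X \<in> card ` {Y \<in> \<I>. Y \<subseteq> X}"
    unfolding rank_of_def
    by (rule Max_in) (use assms in \<open>auto intro: finite_subset[of _ "Pow X"]\<close>)
  then show ?thesis
    using that by auto
qed

context matroid
begin

lemma indep_closure_subset: "F \<in> \<I> \<Longrightarrow> indep_closure E \<I> F \<subseteq> E"
  using indep_subset_ground by (auto simp: indep_closure_def)

lemma rank_of_indep_closure:
  assumes F: "F \<in> \<I>"
  shows "rank_of \<I> (indep_closure E \<I> F) = card F"
proof (rule antisym)
  have finite: "finite (indep_closure E \<I> F)"
    using indep_closure_subset[OF F] finite_ground finite_subset by blast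
  then show "card F \<le> rank_of \<I> (indep_closure E \<I> F)"
    using F by (intro rank_of_ge) (auto simp: indep_closure_def)
  obtain Y where Y: "Y \<in> \<I>" "Y \<subseteq> indep_closure E \<I> F" "card Y = rank_of \<I> (indep_closure E \<I> F)"
    using rank_of_attained[OF finite indep_empty] by blast
  show "rank_of \<I> (indep_closure E \<I> F) \<le> card F"
  proof (rule ccontr)
    assume "\<not> ?thesis"
    then obtain y where "y \<in> Y - F" "insert y F \<in> \<I>"
      using indep_augment[OF F Y(1)] Y(3) by auto
    then show False
      using Y(2) by (auto simp: indep_closure_def)
  qed
qed

lemma hyperplane_indep_closure:
  assumes F: "F \<in> \<I>" "card F + 1 = rank_of \<I> E"
  shows "hyperplane E \<I> (indep_closure E \<I> F)"
proof -
  let ?H = "indep_closure E \<I> F"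
  have finite: "finite F" "finite ?H"
    using indep_subset_ground[OF F(1)] indep_closure_subset[OF F(1)] finite_ground finite_subset
    by auto
  have "rank_of \<I> ?H < rank_of \<I> (insert x ?H)" if x: "x \<in> E - ?H" for x
  proof -
    have "insert x F \<in> \<I>" "x \<notin> F"
      using x by (auto simp: indep_closure_def)
    then have "card (insert x F) \<le> rank_of \<I> (insert x ?H)"
      using finite by (intro rank_of_ge) (auto simp: indep_closure_def)
    then show ?thesis
      using \<open>x \<notin> F\<close> finite by (simp add: rank_of_indep_closure[OF F(1)])
  qed
  then show ?thesis
    using indep_closure_subset[OF F(1)] rank_of_indep_closure[OF F(1)] F(2)
    by (auto simp: hyperplane_def flat_def)
qed

lemma dependent_subset_indep_closure:
  assumes "U \<subseteq> E" "U \<notin> \<I>" "F \<subseteq> U" "card U = Suc (card F)"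
  shows "U \<subseteq> indep_closure E \<I> F"
proof
  fix x assume x: "x \<in> U"
  have finite: "finite U" "finite F"
    using assms(1,3) finite_subset[OF _ finite_ground] by auto
  show "x \<in> indep_closure E \<I> F"
  proof (cases "x \<in> F")
    case False
    then have "insert x F = U"
      using assms(3,4) x finite by (intro card_subset_eq) simp_all
    then have "insert x F \<notin> \<I>"
      using assms(2) by simp
    then show ?thesis
      using assms(1) x by (auto simp: indep_closure_def)
  qed (simp add: indep_closure_def)
qed

end

lemma card_Int_nsets_less:
  assumes "S \<in> nsets E r" "T \<in> nsets E r" "S \<noteq> T"
  shows "card (S \<inter> T) < r"
proof -
  have "S \<inter> T \<noteq> S"
    using assms card_subset_eq[of T S] by (auto simp: nsets_def)
  then have "S \<inter> T \<subset> S"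
    by blast
  then show ?thesis
    using assms psubset_card_mono[of S "S \<inter> T"] by (simp add: nsets_def)
qed

lemma card_Int_nonbases_less:
  assumes sparse: "sparse_paving E \<I>" and r: "rank_of \<I> E = r"
    and S: "S \<in> nonbases E r \<I>" and T: "T \<in> nonbases E r \<I>" and "S \<noteq> T"
  shows "card (S \<inter> T) < r - 1"
proof (rule ccontr)
  assume large: "\<not> ?thesis"
  interpret matroid E \<I>
    using sparse by (simp add: sparse_paving_def paving_def)
  have S': "S \<subseteq> E" "finite S" "card S = r" "S \<notin> \<I>" and T': "T \<subseteq> E" "finite T" "card T = r" "T \<notin> \<I>"
    using S T by (auto simp: nonbases_def nsets_def)
  let ?F = "S \<inter> T" and ?H = "indep_closure E \<I> (S \<inter> T)"
  have card_F: "Suc (card ?F) = r"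
    using card_Int_nsets_less[of S E r T] large S T \<open>S \<noteq> T\<close> by (simp add: nonbases_def)
  moreover have "?F \<subseteq> E"
    using S'(1) by auto
  ultimately have F: "?F \<in> \<I>"
    using sparse r by (auto simp: sparse_paving_def paving_def)
  then have "hyperplane E \<I> ?H"
    using card_F r by (intro hyperplane_indep_closure) auto
  then have "card ?H \<le> r"
    using sparse r unfolding sparse_paving_def by fastforce
  moreover have "S \<union> T \<subseteq> ?H"
    using dependent_subset_indep_closure[of S ?F] dependent_subset_indep_closure[of T ?F]
      S' T' card_F
    by auto
  then have "card (S \<union> T) \<le> card ?H"
    using indep_closure_subset[OF F] finite_ground by (intro card_mono) (auto intro: finite_subset)
  moreover have "card (S \<union> T) = Suc r"
    using card_Un_Int[OF S'(2) T'(2)] S' T' card_F by linarith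
  ultimately show False
    by linarith
qed

lemma nonbases_in_johnson_stable_sets:
  assumes "sparse_paving E \<I>" "rank_of \<I> E = r"
  shows "nonbases E r \<I> \<in> johnson_stable_sets E r"
  using card_Int_nonbases_less[OF assms]
  by (auto simp: johnson_stable_sets_def pairwise_def nonbases_def)

lemma indep_of_nonbases_nonbases:
  assumes "paving E \<I>" "rank_of \<I> E = r"
  shows "indep_of_nonbases E r (nonbases E r \<I>) = \<I>"
proof -
  interpret matroid E \<I>
    using assms(1) by (simp add: paving_def)
  have "X \<in> \<I>" if X: "X \<subseteq> E" "card X \<le> r" "X \<notin> nonbases E r \<I>" for X
  proof (cases "card X < r")
    case True
    then show ?thesis
      using X(1) assms by (simp add: paving_def)
  next
    case False
    then have "X \<in> nsets E r"
      using X finite_subset[OF X(1) finite_ground] by (simp add: nsets_def)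
    then show ?thesis
      using X(3) by (simp add: nonbases_def)
  qed
  moreover have "X \<subseteq> E" "card X \<le> r" if "X \<in> \<I>" for X
    using rank_of_ge[OF finite_ground that indep_subset_ground[OF that]] assms(2)
      indep_subset_ground[OF that] by auto
  ultimately show ?thesis
    by (auto simp: indep_of_nonbases_def nonbases_def)
qed

context
  fixes E :: "'a set" and r :: nat and C :: "'a set set"
  assumes finite_E: "finite E" and stable: "C \<in> johnson_stable_sets E r"
begin

lemma card_Int_johnson_stable_less: "S \<in> C \<Longrightarrow> T \<in> C \<Longrightarrow> S \<noteq> T \<Longrightarrow> card (S \<inter> T) < r - 1"
  using stable unfolding johnson_stable_sets_def by (blast dest: pairwiseD)

lemma indep_of_nonbases_if_card_less: "X \<subseteq> E \<Longrightarrow> card X < r \<Longrightarrow> X \<in> indep_of_nonbases E r C"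
  using stable by (auto simp: indep_of_nonbases_def johnson_stable_sets_def nsets_def)

lemma indep_of_nonbases_augment:
  assumes X: "X \<in> indep_of_nonbases E r C" and Y: "Y \<in> indep_of_nonbases E r C"
    and less: "card X < card Y"
  shows "\<exists>y\<in>Y - X. insert y X \<in> indep_of_nonbases E r C"
proof (rule ccontr)
  assume stuck: "\<not> ?thesis"
  have XY: "X \<subseteq> E" "Y \<subseteq> E" "card Y \<le> r" "Y \<notin> C"
    using X Y by (auto simp: indep_of_nonbases_def)
  then have finite: "finite X" "finite Y"
    using finite_E finite_subset by auto
  have insert_in_C: "insert y X \<in> C" if "y \<in> Y - X" for y
    using stuck that XY less finite by (auto simp: indep_of_nonbases_def)
  obtain y where y: "y \<in> Y - X"
    using less finite card_mono[of X Y] by auto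
  have r: "Suc (card X) = r"
    using insert_in_C[OF y] stable y finite by (auto simp: johnson_stable_sets_def nsets_def)
  have "\<not> Y \<subseteq> insert y X"
  proof
    assume "Y \<subseteq> insert y X"
    then have "Y = insert y X"
      using less y finite by (intro card_seteq) auto
    then show False
      using insert_in_C[OF y] XY by simp
  qed
  then obtain z where z: "z \<in> Y - X" "z \<noteq> y"
    by auto
  have "insert y X \<inter> insert z X = X" "insert y X \<noteq> insert z X"
    using y z by auto
  then have "card X < r - 1"
    using card_Int_johnson_stable_less[OF insert_in_C[OF y] insert_in_C[OF z(1)]] by simp
  then show False
    using r by simp
qed

lemma nset_not_in_johnson_stable_set:
  assumes "X \<subseteq> E" "r < card X" "1 \<le> r"
  obtains S where "S \<subseteq> X" "card S = r" "S \<notin> C"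
proof -
  obtain S where S: "S \<subseteq> X" "card S = r" "finite S"
    using assms obtain_subset_with_card_n[of r X] by (metis less_imp_le)
  obtain x where x: "x \<in> X" "x \<notin> S"
    using S assms(2) by (metis nat_less_le subsetI subset_antisym)
  obtain s where s: "s \<in> S"
    using S assms(3) by fastforce
  define T where "T = insert x (S - {s})"
  have T: "T \<subseteq> X" "card T = r" "S \<inter> T = S - {s}" "S \<noteq> T"
    using S x s assms(3) by (auto simp: T_def)
  have "\<not> card (S \<inter> T) < r - 1"
    using T(3) S s by simp
  then have "S \<notin> C \<or> T \<notin> C"
    using card_Int_johnson_stable_less T(4) by blast
  then show ?thesis
    using S T that by blast
qed

lemma matroid_indep_of_nonbases:
  assumes "1 \<le> r"
  shows "matroid E (indep_of_nonbases E r C)"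
proof
  show "{} \<in> indep_of_nonbases E r C"
    using assms by (intro indep_of_nonbases_if_card_less) auto
  show "Y \<in> indep_of_nonbases E r C" if X: "X \<in> indep_of_nonbases E r C" and "Y \<subseteq> X" for X Y
  proof (cases "Y = X")
    case False
    have XE: "X \<subseteq> E" "card X \<le> r"
      using X by (auto simp: indep_of_nonbases_def)
    then have "card Y < card X"
      using that False finite_E by (intro psubset_card_mono) (auto intro: finite_subset)
    then show ?thesis
      using XE that by (intro indep_of_nonbases_if_card_less) auto
  qed (use X in simp)
qed (use finite_E indep_of_nonbases_augment in \<open>auto simp: indep_of_nonbases_def\<close>)

lemma rank_of_indep_of_nonbases_ge:
  assumes "X \<subseteq> E" "r < card X" "1 \<le> r"
  shows "r \<le> rank_of (indep_of_nonbases E r C) X"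
proof -
  obtain S where S: "S \<subseteq> X" "card S = r" "S \<notin> C"
    using nset_not_in_johnson_stable_set[OF assms] .
  then show ?thesis
    using rank_of_ge[of X S "indep_of_nonbases E r C"] assms(1) finite_subset[OF assms(1) finite_E]
    by (auto simp: indep_of_nonbases_def)
qed

lemma rank_of_indep_of_nonbases:
  assumes "r < card E" "1 \<le> r"
  shows "rank_of (indep_of_nonbases E r C) E = r"
proof (rule antisym)
  interpret matroid E "indep_of_nonbases E r C"
    by (rule matroid_indep_of_nonbases[OF assms(2)])
  obtain Y where "Y \<in> indep_of_nonbases E r C" "card Y = rank_of (indep_of_nonbases E r C) E"
    using rank_of_attained[OF finite_E indep_empty] by blast
  then show "rank_of (indep_of_nonbases E r C) E \<le> r"
    by (auto simp: indep_of_nonbases_def)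
qed (use rank_of_indep_of_nonbases_ge assms in simp)

lemma sparse_paving_indep_of_nonbases:
  assumes r: "r < card E" "1 \<le> r"
  shows "sparse_paving E (indep_of_nonbases E r C)"
proof -
  let ?\<I> = "indep_of_nonbases E r C"
  interpret matroid E ?\<I>
    by (rule matroid_indep_of_nonbases[OF r(2)])
  note rank = rank_of_indep_of_nonbases[OF r]
  have "card X = r - 1 \<or> card X = r" if X: "hyperplane E ?\<I> X" for X
  proof -
    have XE: "X \<subseteq> E" and rank_X: "rank_of ?\<I> X + 1 = r"
      using X rank by (auto simp: hyperplane_def flat_def)
    have finite: "finite X"
      using XE finite_E finite_subset by auto
    obtain Y where "Y \<subseteq> X" "card Y = rank_of ?\<I> X"
      using rank_of_attained[OF finite indep_empty] by blast
    then have "rank_of ?\<I> X \<le> card X"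
      using card_mono[OF finite] by metis
    moreover have "card X \<le> r"
      using rank_of_indep_of_nonbases_ge[OF XE _ r(2)] rank_X by linarith
    ultimately show ?thesis
      using rank_X by linarith
  qed
  then show ?thesis
    using matroid_axioms indep_of_nonbases_if_card_less
    by (simp add: sparse_paving_def paving_def rank)
qed

lemma nonbases_indep_of_nonbases: "nonbases E r (indep_of_nonbases E r C) = C"
  using stable by (auto simp: nonbases_def indep_of_nonbases_def johnson_stable_sets_def nsets_def)

end

lemma num_sparse_paving_eq_card_johnson_stable_sets:
  assumes "1 \<le> r" "r < n"
  shows "num_sparse_paving n r = card (johnson_stable_sets {1..n} r)"
proof -
  have "bij_betw (nonbases {1..n} r) {\<I>. sparse_paving {1..n} \<I> \<and> rank_of \<I> {1..n} = r}
     (johnson_stable_sets {1..n} r)"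
  proof (rule bij_betw_byWitness[where f' = "indep_of_nonbases {1..n} r"])
    show "\<forall>\<I>\<in>{\<I>. sparse_paving {1..n} \<I> \<and> rank_of \<I> {1..n} = r}.
        indep_of_nonbases {1..n} r (nonbases {1..n} r \<I>) = \<I>"
      using indep_of_nonbases_nonbases by (auto simp: sparse_paving_def)
    show "indep_of_nonbases {1..n} r ` johnson_stable_sets {1..n} r
        \<subseteq> {\<I>. sparse_paving {1..n} \<I> \<and> rank_of \<I> {1..n} = r}"
      using assms by (auto simp: sparse_paving_indep_of_nonbases rank_of_indep_of_nonbases)
  qed (auto simp: nonbases_in_johnson_stable_sets nonbases_indep_of_nonbases)
  then show ?thesis
    unfolding num_sparse_paving_def by (rule bij_betw_same_card)
qed

section \<open>The facet hypergraph\<close>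

definition facet_hypergraph :: "'a set \<Rightarrow> nat \<Rightarrow> 'a set set set" where
  "facet_hypergraph E r = (\<lambda>S. nsets S (r - 1)) ` nsets E r"

lemma nsets_Int: "nsets S j \<inter> nsets T j = nsets (S \<inter> T) j"
  by (auto simp: nsets_def)

lemma Union_nsets:
  assumes "0 < j" "j \<le> card S"
  shows "\<Union>(nsets S j) = S"
proof
  show "S \<subseteq> \<Union>(nsets S j)"
  proof
    fix x assume x: "x \<in> S"
    have "finite S"
      using assms by (simp add: card_ge_0_finite)
    then have "j - 1 \<le> card (S - {x})"
      using assms x by simp
    then obtain T where T: "T \<subseteq> S - {x}" "card T = j - 1" "finite T"
      by (rule obtain_subset_with_card_n)
    then have "insert x T \<in> nsets S j"
      using assms x by (auto simp: nsets_def card_insert_if)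
    then show "x \<in> \<Union>(nsets S j)"
      by blast
  qed
qed (auto simp: nsets_def)

lemma inj_on_facets:
  assumes "2 \<le> r"
  shows "inj_on (\<lambda>S. nsets S (r - 1)) (nsets E r)"
  by (rule inj_on_inverseI[where g = Union])
     (use assms in \<open>auto simp: nsets_def intro!: Union_nsets[unfolded nsets_def]\<close>)

lemma card_supersets_of_facet:
  assumes r: "1 \<le> r" "r \<le> card E" and T: "T \<in> nsets E (r - 1)"
  shows "card {S \<in> nsets E r. T \<subseteq> S} = card E - r + 1"
proof -
  have T': "finite T" "T \<subseteq> E" "card T = r - 1"
    using T by (auto simp: nsets_def)
  have "{S \<in> nsets E r. T \<subseteq> S} = (\<lambda>x. insert x T) ` (E - T)"
  proof
    show "(\<lambda>x. insert x T) ` (E - T) \<subseteq> {S \<in> nsets E r. T \<subseteq> S}"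
      using T' r by (auto simp: nsets_def)
    show "{S \<in> nsets E r. T \<subseteq> S} \<subseteq> (\<lambda>x. insert x T) ` (E - T)"
    proof
      fix S assume "S \<in> {S \<in> nsets E r. T \<subseteq> S}"
      then have S: "S \<subseteq> E" "card S = r" "T \<subseteq> S"
        by (auto simp: nsets_def)
      then have "card (S - T) = 1"
        using T' r by (simp add: card_Diff_subset)
      then obtain x where "S - T = {x}"
        by (rule card_1_singletonE)
      then have "S = insert x T" "x \<in> E - T"
        using S by auto
      then show "S \<in> (\<lambda>x. insert x T) ` (E - T)"
        by blast
    qed
  qed
  then have "card {S \<in> nsets E r. T \<subseteq> S} = card (E - T)"
    by (simp only:) (intro card_image inj_onI, auto dest: insert_ident)
  also have "\<dots> = card E - r + 1"
    using T' r by (simp add: card_Diff_subset)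
  finally show ?thesis .
qed

lemma degree_facet_hypergraph:
  assumes r: "2 \<le> r" "r \<le> card E" and T: "T \<in> nsets E (r - 1)"
  shows "degree (facet_hypergraph E r) T = card E - r + 1"
proof -
  have "{e \<in> facet_hypergraph E r. T \<in> e} = (\<lambda>S. nsets S (r - 1)) ` {S \<in> nsets E r. T \<subseteq> S}"
    using T by (auto simp: facet_hypergraph_def nsets_def)
  moreover have "inj_on (\<lambda>S. nsets S (r - 1)) {S \<in> nsets E r. T \<subseteq> S}"
    using inj_on_facets[OF r(1)] by (rule inj_on_subset) auto
  ultimately have "degree (facet_hypergraph E r) T = card {S \<in> nsets E r. T \<subseteq> S}"
    by (simp add: degree_def card_image)
  then show ?thesis
    using card_supersets_of_facet[OF _ r(2) T] r(1) by simp
qed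

lemma card_Int_facets_le:
  assumes S: "S \<in> nsets E r" and T: "T \<in> nsets E r" and "S \<noteq> T"
  shows "card (nsets S (r - 1) \<inter> nsets T (r - 1)) \<le> 1"
proof -
  have "finite (S \<inter> T)"
    using S by (simp add: nsets_def)
  then have "card (nsets S (r - 1) \<inter> nsets T (r - 1)) = card (S \<inter> T) choose (r - 1)"
    by (simp add: nsets_Int card_nsets)
  also have "\<dots> \<le> (r - 1) choose (r - 1)"
    using card_Int_nsets_less[OF assms] by (intro binomial_right_mono) simp
  finally show ?thesis
    by simp
qed

lemma regular_linear_hypergraph_facets:
  assumes E: "finite E" and r: "2 \<le> r" "r \<le> card E"
  shows "regular_linear_hypergraph (nsets E (r - 1)) (facet_hypergraph E r) r (card E - r + 1)"
proof
  have card_facets: "card e = r" if "e \<in> facet_hypergraph E r" for e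
  proof -
    obtain S where S: "S \<in> nsets E r" "e = nsets S (r - 1)"
      using \<open>e \<in> facet_hypergraph E r\<close> by (auto simp: facet_hypergraph_def)
    then have "finite S" "card S = r"
      by (auto simp: nsets_def)
    then show ?thesis
      using r binomial_symmetric[of "r - 1" r] by (simp add: S(2) card_nsets)
  qed
  then show "e \<in> facet_hypergraph E r \<Longrightarrow> card e = r" for e .
  show "{} \<notin> facet_hypergraph E r"
    using card_facets[of "{}"] r(1) by auto
  show "finite (nsets E (r - 1))"
    by (rule finite_imp_finite_nsets[OF E])
  show "facet_hypergraph E r \<subseteq> Pow (nsets E (r - 1))"
    by (auto simp: facet_hypergraph_def nsets_def)
  show "card (e \<inter> f) \<le> 1" if "e \<in> facet_hypergraph E r" "f \<in> facet_hypergraph E r" "e \<noteq> f" for e f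
    using that card_Int_facets_le by (auto simp: facet_hypergraph_def)
  show "nsets E (r - 1) \<noteq> {}"
    using r by (auto simp: nsets_eq_empty_iff)
qed (use r degree_facet_hypergraph[OF r] in auto)

lemma pairwise_disjnt_facets_iff:
  assumes r: "2 \<le> r" and C: "C \<subseteq> nsets E r"
  shows "pairwise disjnt ((\<lambda>S. nsets S (r - 1)) ` C) \<longleftrightarrow> pairwise (\<lambda>S T. card (S \<inter> T) < r - 1) C"
proof -
  have "disjnt (nsets S (r - 1)) (nsets T (r - 1)) \<longleftrightarrow> card (S \<inter> T) < r - 1" if "S \<in> C" for S T
    using that C by (auto simp: disjnt_def nsets_Int nsets_eq_empty_iff) (auto simp: nsets_def)
  moreover have "nsets S (r - 1) = nsets T (r - 1) \<longleftrightarrow> S = T" if "S \<in> C" "T \<in> C" for S T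
    using inj_on_eq_iff[OF inj_on_facets[OF r], of S E T] C that by auto
  ultimately show ?thesis
    by (simp add: pairwise_image pairwise_def)
qed

lemma card_johnson_stable_sets_eq_card_matchings:
  assumes r: "2 \<le> r"
  shows "card (johnson_stable_sets E r) = card (matchings (facet_hypergraph E r))"
proof -
  let ?facets = "\<lambda>S. nsets S (r - 1)"
  have "bij_betw ((`) ?facets) (Pow (nsets E r)) (Pow (facet_hypergraph E r))"
    unfolding facet_hypergraph_def by (intro bij_betw_Pow inj_on_imp_bij_betw inj_on_facets r)
  then have inj: "inj_on ((`) ?facets) (Pow (nsets E r))"
    and image: "(`) ?facets ` Pow (nsets E r) = Pow (facet_hypergraph E r)"
    by (auto simp: bij_betw_def)
  have "matchings (facet_hypergraph E r) = {M \<in> (`) ?facets ` Pow (nsets E r). pairwise disjnt M}"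
    unfolding image by (auto simp: matchings_def)
  then have "matchings (facet_hypergraph E r) = (`) ?facets ` johnson_stable_sets E r"
    using pairwise_disjnt_facets_iff[OF r] by (auto simp: johnson_stable_sets_def)
  moreover have "inj_on ((`) ?facets) (johnson_stable_sets E r)"
    using inj by (rule inj_on_subset) (auto simp: johnson_stable_sets_def)
  ultimately show ?thesis
    by (simp add: card_image)
qed

section \<open>The number of sparse paving matroids\<close>

lemma num_sparse_paving_eq_card_matchings:
  assumes "2 \<le> r" "r < n"
  shows "num_sparse_paving n r = card (matchings (facet_hypergraph {1..n} r))"
  using assms num_sparse_paving_eq_card_johnson_stable_sets[of r n]
    card_johnson_stable_sets_eq_card_matchings[of r "{1..n}"] by simp

lemma binomial_pred_le_power:
  assumes "2 * r \<le> n" "1 \<le> r"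
  shows "real (n choose (r - 1)) \<le> real (n - r + 1) ^ (2 * r)"
proof -
  define D where "D = n - r + 1"
  have D: "2 \<le> D" "n \<le> 2 * D"
    using assms by (auto simp: D_def)
  have "n \<le> D ^ 2"
    using D by (simp add: power2_eq_square order_trans[OF _ mult_right_mono])
  have "n choose (r - 1) \<le> n ^ (r - 1)"
    using assms by (intro binomial_le_pow) auto
  also have "\<dots> \<le> n ^ r"
    using assms by (intro power_increasing) auto
  also have "\<dots> \<le> (D ^ 2) ^ r"
    using \<open>n \<le> D ^ 2\<close> by (rule power_mono) simp
  also have "\<dots> = D ^ (2 * r)"
    by (simp add: power_mult)
  finally have "real (n choose (r - 1)) \<le> real (D ^ (2 * r))"
    by (rule of_nat_mono)
  then show ?thesis
    by (simp add: D_def)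
qed

lemma binomial_pred_divide_eq:
  assumes "1 \<le> r" "r \<le> n"
  shows "real (n choose (r - 1)) / real r = 1 / (real n - real r + 1) * real (n choose r)"
proof -
  have "Suc (r - 1) * (n choose Suc (r - 1)) = (n - (r - 1)) * (n choose (r - 1))"
    by (simp only: binomial_absorption binomial_absorb_comp)
  then have "r * (n choose r) = (n - r + 1) * (n choose (r - 1))"
    using assms by (simp add: Suc_diff_le)
  then have "real r * real (n choose r) = real (n - r + 1) * real (n choose (r - 1))"
    by (metis of_nat_mult)
  then show ?thesis
    using assms by (simp add: field_simps of_nat_diff)
qed

lemma eventually_ln_num_sparse_paving_near:
  fixes \<eta> :: real
  assumes r: "2 \<le> r" and \<eta>: "0 < \<eta>"
  defines "P \<equiv> \<lambda>n. 1 / (real n - real r + 1) * real (n choose r)"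
    and "L \<equiv> \<lambda>n. ln (real n - real r + 1) + 1 - real r"
  shows "\<forall>\<^sub>F n in sequentially. \<bar>ln (real (num_sparse_paving n r)) / P n - L n\<bar> \<le> \<eta>"
proof -
  have "filterlim (\<lambda>n. n - r + 1) at_top sequentially"
    by real_asymp
  note in_terms_of_n = eventually_compose_filterlim[OF _ this]
  show ?thesis
    using eventually_ge_at_top[of "2 * r"]
      in_terms_of_n[OF eventually_ln_card_matchings_ge[where 'v = "nat set", OF \<eta> r, of "2 * r"]]
      in_terms_of_n[OF eventually_ln_card_matchings_le[where 'v = "nat set", OF \<eta>, of r "2 * r"]]
  proof eventually_elim
    case (elim n)
    have hypergraph: "regular_linear_hypergraph
        (nsets {1..n} (r - 1)) (facet_hypergraph {1..n} r) r (n - r + 1)"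
      using regular_linear_hypergraph_facets[of "{1..n}" r] elim(1) r by simp
    have card: "card (nsets {1..n} (r - 1)) = n choose (r - 1)"
      by (simp add: card_nsets)
    have size: "real (card (nsets {1..n} (r - 1))) / real r = P n"
      using binomial_pred_divide_eq[of r n] elim(1) r by (simp add: card P_def)
    have "0 < P n"
      using elim(1) r by (simp add: P_def)
    have "real (card (nsets {1..n} (r - 1))) \<le> real (n - r + 1) ^ (2 * r)"
      using binomial_pred_le_power[of r n] elim(1) r by (simp add: card)
    moreover have "L n = ln (real (n - r + 1)) + 1 - real r"
      using elim(1) by (simp add: L_def of_nat_diff)
    moreover have "num_sparse_paving n r = card (matchings (facet_hypergraph {1..n} r))"
      using num_sparse_paving_eq_card_matchings[of r n] elim(1) r by simp
    ultimately have "P n * (L n - \<eta>) \<le> ln (real (num_sparse_paving n r))"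
      "ln (real (num_sparse_paving n r)) \<le> P n * (L n + \<eta>)"
      using elim(2,3) hypergraph by (simp_all only: flip: size)
    then show ?case
      using \<open>0 < P n\<close> by (simp add: abs_le_iff field_simps)
  qed
qed

theorem theorem3:
  fixes r :: nat
  assumes "r \<ge> 3"
  shows "\<exists>\<epsilon> :: nat \<Rightarrow> real. \<epsilon> \<in> o(\<lambda>_. 1) \<and>
    (\<forall>n\<ge>r. ln (real (num_sparse_paving n r)) =
       1 / (real n - real r + 1) * real (n choose r) *
         (ln (real n - real r + 1) + 1 - real r + \<epsilon> n))"
proof -
  define P where "P n = 1 / (real n - real r + 1) * real (n choose r)" for n
  define L where "L n = ln (real n - real r + 1) + 1 - real r" for n
  define \<epsilon> where "\<epsilon> n = ln (real (num_sparse_paving n r)) / P n - L n" for n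
  have "\<forall>\<^sub>F n in sequentially. norm (\<epsilon> n) \<le> \<eta> * norm (1 :: real)" if "0 < \<eta>" for \<eta> :: real
    using eventually_ln_num_sparse_paving_near[of r \<eta>] that assms by (simp add: \<epsilon>_def P_def L_def)
  then have "\<epsilon> \<in> o(\<lambda>_. 1)"
    by (rule landau_o.smallI)
  moreover have "ln (real (num_sparse_paving n r)) = P n * (L n + \<epsilon> n)" if "r \<le> n" for n
    using that by (simp add: \<epsilon>_def P_def)
  ultimately show ?thesis
    unfolding P_def L_def by blast
qed

end
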